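(* Assume (A1) and (A2), and let $\ell_n=n^s$ with $s\in(0.5,0.75)$. Then, for any Lipschitz-continuous $\mu$ and any càdlàg $\sigma:[0,1]\to[\sigma_0,\infty)$ (no null hypothesis is assumed), $$U(n)\xrightarrow{P}\int_0^1\int_0^1\big|\log\sigma^2(x)-\log\sigma^2(y)\big|\,dx\,dy\qquad(n\to\infty).$$
   Context: Let $(Y_i)_{i\in\mathbb N}$ be a strictly stationary real-valued process with $E[Y_1]=0$, $\mathrm{Var}(Y_1)=1$, which is absolutely regular, i.e. $\beta_Y(k):=\sup_{m\in\mathbb N}\beta\big(\sigma(Y_i,1\le i\le m),\sigma(Y_i,i\ge k+m)\big)\to0$ as $k\to\infty$, where $\beta(\mathcal A,\mathcal B)=E\big[\operatorname{ess\,sup}_{A\in\mathcal A}|P(A\mid\mathcal B)-P(A)|\big]$. Let $\mu:[0,1]\to\mathbb R$ be Lipschitz-continuous and $\sigma:[0,1]\to[\sigma_0,\infty)$ be càdlàg for some constant $\sigma_0>0$. The observations form the triangular array $X_i=X_{i,n}=\sigma(i/n)Y_i+\mu(i/n)$, $1\le i\le n$. The null hypothesis means $\sigma\equiv\sigma_H$ for a constant $\sigma_H>0$. The long-run variance $\kappa^2:=\mathrm{Var}(Y_1^2)+2\sum_{k\ge1}\mathrm{Cov}(Y_1^2,Y_{k+1}^2)$ is assumed finite and strictly positive; $\kappa>0$ denotes its positive square root. For $s\in(0,1)$ the block length is $\ell_n=n^s$ and the number of blocks is $b_n=n/\ell_n$ (both assumed to be integers). The $j$-th block is $\{(j-1)\ell_n+1,\dots,j\ell_n\}$,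 and $\hat\sigma_j^2=\frac1{\ell_n}\sum_{i=(j-1)\ell_n+1}^{j\ell_n}\big(X_i-\frac1{\ell_n}\sum_{r=(j-1)\ell_n+1}^{j\ell_n}X_r\big)^2$. The test statistic is $U(n)=\frac{1}{b_n(b_n-1)}\sum_{1\le j\ne k\le b_n}|\log\hat\sigma_j^2-\log\hat\sigma_k^2|$. Assumptions: (A1) there is $\vartheta>0$ with $E|Y_1|^{4+2\vartheta}<\infty$; (A2) for the same $\vartheta$, $\sum_{k=1}^\infty\beta_Y(k)^{\vartheta/(2+\vartheta)}<\infty$. *)

theory Defs
  imports "HOL-Probability.Probability"
begin

definition gen_sigma :: "'a measure \<Rightarrow> (nat \<Rightarrow> 'a \<Rightarrow> real) \<Rightarrow> nat set \<Rightarrow> 'a measure" where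
  "gen_sigma M Y I = sigma (space M) (\<Union>i\<in>I. {Y i -` B \<inter> space M | B. B \<in> sets borel})"

definition ess_sup_fam :: "'a measure \<Rightarrow> ('a \<Rightarrow> real) set \<Rightarrow> ('a \<Rightarrow> real)" where
  "ess_sup_fam M G = (SOME g. g \<in> borel_measurable M
      \<and> (\<forall>f\<in>G. AE x in M. f x \<le> g x)
      \<and> (\<forall>h\<in>borel_measurable M. (\<forall>f\<in>G. AE x in M. f x \<le> h x) \<longrightarrow> (AE x in M. g x \<le> h x)))"

definition beta_coef :: "'a measure \<Rightarrow> 'a measure \<Rightarrow> 'a measure \<Rightarrow> real" where
  "beta_coef M \<A> \<B> = integral\<^sup>L M
     (ess_sup_fam M {(\<lambda>\<omega>. \<bar>real_cond_exp M \<B> (indicator A) \<omega> - measure M A\<bar>) | A. A \<in> sets \<A>})"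

definition beta_proc :: "'a measure \<Rightarrow> (nat \<Rightarrow> 'a \<Rightarrow> real) \<Rightarrow> nat \<Rightarrow> real" where
  "beta_proc M Y k = (SUP m\<in>{1..}. beta_coef M (gen_sigma M Y {1..m}) (gen_sigma M Y {k+m..}))"

definition strictly_stationary :: "'a measure \<Rightarrow> (nat \<Rightarrow> 'a \<Rightarrow> real) \<Rightarrow> bool" where
  "strictly_stationary M Y \<longleftrightarrow> (\<forall>m h.
     distr M (PiM {1..m} (\<lambda>_. borel)) (\<lambda>\<omega>. \<lambda>i\<in>{1..m}. Y (i + h) \<omega>)
   = distr M (PiM {1..m} (\<lambda>_. borel)) (\<lambda>\<omega>. \<lambda>i\<in>{1..m}. Y i \<omega>))"

definition covariance :: "'a measure \<Rightarrow> ('a \<Rightarrow> real) \<Rightarrow> ('a \<Rightarrow> real) \<Rightarrow> real" where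
  "covariance M X Z = integral\<^sup>L M (\<lambda>\<omega>. (X \<omega> - integral\<^sup>L M X) * (Z \<omega> - integral\<^sup>L M Z))"

definition cadlag01 :: "(real \<Rightarrow> real) \<Rightarrow> bool" where
  "cadlag01 f \<longleftrightarrow> (\<forall>x\<in>{0..<1}. continuous (at_right x) f) \<and> (\<forall>x\<in>{0<..1}. \<exists>L. (f \<longlongrightarrow> L) (at_left x))"

definition obs :: "(real \<Rightarrow> real) \<Rightarrow> (real \<Rightarrow> real) \<Rightarrow> (nat \<Rightarrow> 'a \<Rightarrow> real) \<Rightarrow> nat \<Rightarrow> nat \<Rightarrow> 'a \<Rightarrow> real" where
  "obs \<sigma> \<mu> Y n i \<omega> = \<sigma> (real i / real n) * Y i \<omega> + \<mu> (real i / real n)"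

text \<open>Block length l_n = n^s and number of blocks b_n = n / l_n (exact when both are integers).\<close>
definition blen :: "real \<Rightarrow> nat \<Rightarrow> nat" where
  "blen s n = nat \<lfloor>real n powr s\<rfloor>"

definition bnum :: "real \<Rightarrow> nat \<Rightarrow> nat" where
  "bnum s n = n div blen s n"

definition admissible_n :: "real \<Rightarrow> nat set" where
  "admissible_n s = {n. real n powr s \<in> \<nat> \<and> real n / real n powr s \<in> \<nat>}"

definition block_var :: "(real \<Rightarrow> real) \<Rightarrow> (real \<Rightarrow> real) \<Rightarrow> (nat \<Rightarrow> 'a \<Rightarrow> real) \<Rightarrow> real \<Rightarrow> nat \<Rightarrow> nat \<Rightarrow> 'a \<Rightarrow> real" where
  "block_var \<sigma> \<mu> Y s n j \<omega> =
     (let l = blen s n; B = {(j - 1) * l + 1 .. j * l};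
          m = (1 / real l) * (\<Sum>r\<in>B. obs \<sigma> \<mu> Y n r \<omega>)
      in (1 / real l) * (\<Sum>i\<in>B. (obs \<sigma> \<mu> Y n i \<omega> - m)^2))"

definition U_stat :: "(real \<Rightarrow> real) \<Rightarrow> (real \<Rightarrow> real) \<Rightarrow> (nat \<Rightarrow> 'a \<Rightarrow> real) \<Rightarrow> real \<Rightarrow> nat \<Rightarrow> 'a \<Rightarrow> real" where
  "U_stat \<sigma> \<mu> Y s n \<omega> =
     (let b = bnum s n
      in (1 / (real b * (real b - 1))) *
         (\<Sum>j\<in>{1..b}. \<Sum>k\<in>{1..b} - {j}.
            \<bar>ln (block_var \<sigma> \<mu> Y s n j \<omega>) - ln (block_var \<sigma> \<mu> Y s n k \<omega>)\<bar>))"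

definition tendsto_in_prob :: "'a measure \<Rightarrow> ('i \<Rightarrow> 'a \<Rightarrow> real) \<Rightarrow> real \<Rightarrow> 'i filter \<Rightarrow> bool" where
  "tendsto_in_prob M Z c F \<longleftrightarrow>
     (\<forall>\<epsilon>>0. ((\<lambda>n. measure M {\<omega>\<in>space M. \<bar>Z n \<omega> - c\<bar> > \<epsilon>}) \<longlongrightarrow> 0) F)"

end

theory Submission
  imports Defs "HOL-Real_Asymp.Real_Asymp"
begin

text \<open>On a block the observations are a weighted copy of the noise plus a drift that varies by
  \<open>O(1 / b)\<close>. Expanding the empirical variance, it differs from the block average of \<open>\<sigma>\<^sup>2\<close> by three
  weighted sums of \<open>Y\<^sub>i\<^sup>2 - 1\<close> and \<open>Y\<^sub>i\<close> and a negligible drift term. Absolute regularity dominates the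
  strong mixing coefficient, so a truncated covariance inequality bounds the second moments of these
  sums by a multiple of the block length \<open>\<ell>\<close>. Since \<open>b / \<ell> = n\<^sup>1\<^sup>-\<^sup>2\<^sup>s \<rightarrow> 0\<close>, Chebyshev's inequality and
  a union bound make all \<open>b\<close> block variances simultaneously close to the block averages of \<open>\<sigma>\<^sup>2\<close>, which
  are bounded below by \<open>\<sigma>\<^sub>0\<^sup>2\<close>, where the logarithm is Lipschitz. The remaining deterministic double sum
  is a double integral of step functions, which converge almost everywhere because a cadlag function
  has countably many discontinuities.\<close>

subsection \<open>Essential suprema and the absolute regularity coefficient\<close>

lemma (in prob_space) essential_supremum_exists:
  fixes G :: "('a \<Rightarrow> real) set"
  assumes meas: "\<And>f. f \<in> G \<Longrightarrow> f \<in> borel_measurable M"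
    and bounds: "\<And>f. f \<in> G \<Longrightarrow> AE x in M. 0 \<le> f x \<and> f x \<le> 1"
    and ne: "G \<noteq> {}"
  shows "\<exists>g\<in>borel_measurable M. (\<forall>f\<in>G. AE x in M. f x \<le> g x)
      \<and> (\<forall>h\<in>borel_measurable M. (\<forall>f\<in>G. AE x in M. f x \<le> h x) \<longrightarrow> (AE x in M. g x \<le> h x))"
proof -
  define c where "c f x = max 0 (min 1 (f x))" for f :: "'a \<Rightarrow> real" and x
  define S where "S u x = (SUP n. c (u n) x)" for u :: "nat \<Rightarrow> 'a \<Rightarrow> real" and x
  have cb: "0 \<le> c f x" "c f x \<le> 1" for f x
    by (auto simp: c_def)
  have bdd: "bdd_above (range (\<lambda>n. c (u n) x))" for u :: "nat \<Rightarrow> 'a \<Rightarrow> real" and x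
    using cb by (intro bdd_aboveI[of _ 1]) auto
  have cS: "c (u n) x \<le> S u x" for u n x
    unfolding S_def by (intro cSUP_upper bdd) auto
  have S_le: "S u x \<le> t" if "\<And>n. c (u n) x \<le> t" for u x t
    unfolding S_def using that by (intro cSUP_least) auto
  have S0: "0 \<le> S u x" for u x
    using cS[of u 0 x] cb(1)[of "u 0" x] by simp
  have S1: "S u x \<le> 1" for u x
    by (intro S_le cb)
  have c_meas: "c f \<in> borel_measurable M" if "f \<in> G" for f
    using meas[OF that] unfolding c_def by measurable
  have S_meas: "S u \<in> borel_measurable M" if "u \<in> UNIV \<rightarrow> G" for u
    unfolding S_def using that by (intro borel_measurable_cSUP c_meas bdd) auto
  have S_int: "integrable M (S u)" if "u \<in> UNIV \<rightarrow> G" for u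
    using S_meas[OF that] S0 S1 by (intro integrable_const_bound[of _ 1]) auto
  have c_AE: "AE x in M. c f x = f x" if "f \<in> G" for f
    using bounds[OF that] by eventually_elim (auto simp: c_def)
  let ?V = "(\<lambda>u. integral\<^sup>L M (S u)) ` (UNIV \<rightarrow> G)"
  have int1: "integral\<^sup>L M (S u) \<le> 1" if "u \<in> UNIV \<rightarrow> G" for u
    using S_int[OF that] S1 by (intro integral_le_const) auto
  have bddV: "bdd_above ?V"
    by (intro bdd_aboveI[of _ 1]) (use int1 in auto)
  obtain f0 where "f0 \<in> G" using ne by auto
  then have "(\<lambda>_::nat. f0) \<in> UNIV \<rightarrow> G" by auto
  then have neV: "?V \<noteq> {}" by blast
  have "\<exists>u. u \<in> UNIV \<rightarrow> G \<and> Sup ?V - 1 / real (Suc k) < integral\<^sup>L M (S u)" for k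
  proof -
    have "Sup ?V - 1 / real (Suc k) < Sup ?V" by simp
    then show ?thesis
      using less_cSup_iff[OF neV bddV] by blast
  qed
  then obtain U where U: "\<And>k. U k \<in> UNIV \<rightarrow> G"
      "\<And>k. Sup ?V - 1 / real (Suc k) < integral\<^sup>L M (S (U k))"
    by metis
  define v where "v n = U (fst (prod_decode n)) (snd (prod_decode n))" for n
  have v: "v \<in> UNIV \<rightarrow> G"
    using U(1) unfolding v_def by (auto simp: Pi_iff)
  have UV: "S (U k) x \<le> S v x" for k x
  proof (rule S_le)
    fix n
    show "c (U k n) x \<le> S v x"
      using cS[of v "prod_encode (k, n)" x] by (simp add: v_def)
  qed
  have "Sup ?V \<le> integral\<^sup>L M (S v)"
  proof (rule field_le_epsilon)
    fix e :: real assume "e > 0"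
    then obtain k where k: "1 / real (Suc k) < e"
      using nat_approx_posE by blast
    have "integral\<^sup>L M (S (U k)) \<le> integral\<^sup>L M (S v)"
      using S_int U(1) v UV by (intro integral_mono) auto
    with U(2)[of k] k show "Sup ?V \<le> integral\<^sup>L M (S v) + e" by linarith
  qed
  then have max: "integral\<^sup>L M (S u) \<le> integral\<^sup>L M (S v)" if "u \<in> UNIV \<rightarrow> G" for u
    using cSup_upper[OF _ bddV] that by (meson imageI order_trans)
  show ?thesis
  proof (intro bexI conjI ballI impI)
    show "S v \<in> borel_measurable M" by (rule S_meas[OF v])
    fix f assume f: "f \<in> G"
    define w where "w = case_nat f v"
    have w: "w \<in> UNIV \<rightarrow> G"
      using f v by (auto simp: w_def Pi_iff split: nat.splits)
    have vw: "S v x \<le> S w x" for x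
    proof (rule S_le)
      fix n show "c (v n) x \<le> S w x"
        using cS[of w "Suc n" x] by (simp add: w_def)
    qed
    have "AE x in M. S v x = S w x"
      using vw S_int v w max[OF w] integral_mono[of M "S v" "S w"]
      by (intro integral_ineq_eq_0_then_AE) (auto intro: antisym)
    with c_AE[OF f] show "AE x in M. f x \<le> S v x"
    proof eventually_elim
      case (elim x)
      then show ?case using cS[of w 0 x] by (simp add: w_def)
    qed
  next
    fix h :: "'a \<Rightarrow> real" assume h: "\<forall>f\<in>G. AE x in M. f x \<le> h x"
    have "AE x in M. \<forall>n. c (v n) x \<le> h x"
    proof (subst AE_all_countable, rule allI)
      fix n
      have "v n \<in> G" using v by auto
      from c_AE[OF this] h[rule_format, OF this] show "AE x in M. c (v n) x \<le> h x"
        by eventually_elim auto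
    qed
    then show "AE x in M. S v x \<le> h x"
      by eventually_elim (auto intro: S_le)
  qed
qed

lemma (in prob_space) abs_cond_prob_diff_bounds:
  assumes "subalgebra M \<B>" "A \<in> sets M"
  shows "AE \<omega> in M. 0 \<le> \<bar>real_cond_exp M \<B> (indicator A) \<omega> - prob A\<bar>
     \<and> \<bar>real_cond_exp M \<B> (indicator A) \<omega> - prob A\<bar> \<le> 1"
proof -
  interpret B: sigma_finite_subalgebra M \<B>
    using assms(1) by (intro finite_measure_subalgebra_is_sigma_finite)
      (simp add: finite_measure_subalgebra_def finite_measure_subalgebra_axioms_def finite_measure_axioms)
  have i: "integrable M (indicator A :: 'a \<Rightarrow> real)"
    using assms(2) by (simp add: emeasure_eq_measure)
  have "AE \<omega> in M. real_cond_exp M \<B> (indicator A) \<omega> \<ge> 0"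
    by (rule B.real_cond_exp_ge_c[OF i]) auto
  moreover have "AE \<omega> in M. real_cond_exp M \<B> (indicator A) \<omega> \<le> 1"
    by (rule B.real_cond_exp_le_c[OF i]) (auto simp: indicator_def)
  ultimately show ?thesis
  proof eventually_elim
    case (elim \<omega>)
    then show ?case using prob_le_1[of A] measure_nonneg[of M A] unfolding abs_le_iff by linarith
  qed
qed

text \<open>Minimality of the essential supremum is needed as well: it makes the integrand bounded, so
  that the Bochner integral in \<^const>\<open>beta_coef\<close> does not degenerate to \<open>0\<close>.\<close>

lemma (in prob_space) beta_coef_bounds:
  assumes \<A>: "subalgebra M \<A>" and \<B>: "subalgebra M \<B>"
  shows "0 \<le> beta_coef M \<A> \<B>" "beta_coef M \<A> \<B> \<le> 1"
    and "\<And>A. A \<in> sets \<A> \<Longrightarrow>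
      (\<integral>\<omega>. \<bar>real_cond_exp M \<B> (indicator A) \<omega> - prob A\<bar> \<partial>M) \<le> beta_coef M \<A> \<B>"
proof -
  define G where "G = {(\<lambda>\<omega>. \<bar>real_cond_exp M \<B> (indicator A) \<omega> - prob A\<bar>) | A. A \<in> sets \<A>}"
  have sub: "A \<in> sets M" if "A \<in> sets \<A>" for A
    using that \<A> by (auto simp: subalgebra_def)
  have meas: "f \<in> borel_measurable M" if "f \<in> G" for f
    using that unfolding G_def by auto
  have bounds: "AE x in M. 0 \<le> f x \<and> f x \<le> 1" if "f \<in> G" for f
    using that abs_cond_prob_diff_bounds[OF \<B> sub] unfolding G_def by auto
  have empty: "(\<lambda>\<omega>. \<bar>real_cond_exp M \<B> (indicator {}) \<omega> - prob {}\<bar>) \<in> G"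
    unfolding G_def by blast
  define g where "g = ess_sup_fam M G"
  have "\<exists>g. g \<in> borel_measurable M \<and> (\<forall>f\<in>G. AE x in M. f x \<le> g x)
      \<and> (\<forall>h\<in>borel_measurable M. (\<forall>f\<in>G. AE x in M. f x \<le> h x) \<longrightarrow> (AE x in M. g x \<le> h x))"
    using essential_supremum_exists[of G] meas bounds empty by blast
  from someI_ex[OF this]
  have g: "g \<in> borel_measurable M" "\<And>f. f \<in> G \<Longrightarrow> AE x in M. f x \<le> g x"
      "\<And>h. h \<in> borel_measurable M \<Longrightarrow> (\<forall>f\<in>G. AE x in M. f x \<le> h x) \<Longrightarrow> AE x in M. g x \<le> h x"
    unfolding g_def ess_sup_fam_def by auto
  have beta: "beta_coef M \<A> \<B> = integral\<^sup>L M g"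
    by (simp add: beta_coef_def g_def G_def)
  have g1: "AE x in M. g x \<le> 1"
    using bounds by (intro g(3)) auto
  have g0: "AE x in M. 0 \<le> g x"
    using g(2)[OF empty] bounds[OF empty] by eventually_elim linarith
  have gi: "integrable M g"
    by (rule integrable_const_bound[of _ 1]) (use g(1) g0 g1 in auto)
  show "0 \<le> beta_coef M \<A> \<B>"
    unfolding beta by (rule integral_nonneg_AE[OF g0])
  show "beta_coef M \<A> \<B> \<le> 1"
    unfolding beta by (rule integral_le_const[OF gi g1])
  fix A assume "A \<in> sets \<A>"
  then have f: "(\<lambda>\<omega>. \<bar>real_cond_exp M \<B> (indicator A) \<omega> - prob A\<bar>) \<in> G" (is "?f \<in> G")
    unfolding G_def by blast
  have "integrable M ?f"
    by (rule integrable_const_bound[of _ 1]) (use bounds[OF f] meas[OF f] in auto)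
  then show "integral\<^sup>L M ?f \<le> beta_coef M \<A> \<B>"
    unfolding beta by (intro integral_mono_AE gi g(2)[OF f])
qed

lemma (in prob_space) integrable_bounded_mult:
  fixes f g :: "'a \<Rightarrow> real"
  assumes "f \<in> borel_measurable M" "g \<in> borel_measurable M"
    and "\<And>x. \<bar>f x\<bar> \<le> S" "\<And>x. \<bar>g x\<bar> \<le> T"
  shows "integrable M f" "integrable M (\<lambda>x. f x * g x)"
proof -
  show "integrable M f"
    using assms by (intro integrable_const_bound[of _ S]) auto
  have "\<bar>f x * g x\<bar> \<le> S * T" for x
    unfolding abs_mult using assms(3,4)[of x] by (intro mult_mono) linarith+
  then show "integrable M (\<lambda>x. f x * g x)"
    using assms(1,2) by (intro integrable_const_bound[of _ "S * T"]) auto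
qed

lemma (in prob_space) cov_indicator_bound:
  assumes \<A>: "subalgebra M \<A>" and \<B>: "subalgebra M \<B>" and A: "A \<in> sets \<A>"
    and g: "g \<in> borel_measurable \<B>" "\<And>x. \<bar>g x\<bar> \<le> T"
  shows "\<bar>(\<integral>x. indicator A x * g x \<partial>M) - prob A * (\<integral>x. g x \<partial>M)\<bar> \<le> T * beta_coef M \<A> \<B>"
proof -
  interpret B: sigma_finite_subalgebra M \<B>
    using \<B> by (intro finite_measure_subalgebra_is_sigma_finite)
      (simp add: finite_measure_subalgebra_def finite_measure_subalgebra_axioms_def finite_measure_axioms)
  have AM: "A \<in> sets M" using A \<A> by (auto simp: subalgebra_def)
  have gM[measurable]: "g \<in> borel_measurable M"
    using measurable_from_subalg[OF \<B> g(1)] .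
  have T0: "0 \<le> T" using g(2)[of undefined] by linarith
  let ?p = "real_cond_exp M \<B> (indicator A)"
  have ig: "integrable M (\<lambda>x. g x * indicator A x)" "integrable M g"
    using integrable_bounded_mult[of g "indicator A" T 1] g(2) AM by (auto simp: indicator_def)
  have 1: "integrable M (\<lambda>x. g x * ?p x)" "(\<integral>x. g x * ?p x \<partial>M) = (\<integral>x. g x * indicator A x \<partial>M)"
    using B.real_cond_exp_intg[OF ig(1) g(1)] AM by auto
  have ip: "integrable M (\<lambda>x. \<bar>?p x - prob A\<bar>)"
    by (rule integrable_const_bound[of _ 1]) (use abs_cond_prob_diff_bounds[OF \<B> AM] in auto)
  have "(\<integral>x. indicator A x * g x \<partial>M) - prob A * (\<integral>x. g x \<partial>M) = (\<integral>x. g x * ?p x - g x * prob A \<partial>M)"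
    using 1 ig by (simp add: mult.commute)
  also have "\<bar>\<dots>\<bar> \<le> (\<integral>x. \<bar>g x * ?p x - g x * prob A\<bar> \<partial>M)"
    by (rule integral_abs_bound)
  also have "\<dots> \<le> (\<integral>x. T * \<bar>?p x - prob A\<bar> \<partial>M)"
  proof (rule integral_mono)
    show "integrable M (\<lambda>x. \<bar>g x * ?p x - g x * prob A\<bar>)" using 1 ig by auto
    show "integrable M (\<lambda>x. T * \<bar>?p x - prob A\<bar>)" using ip by auto
    fix x show "\<bar>g x * ?p x - g x * prob A\<bar> \<le> T * \<bar>?p x - prob A\<bar>"
      using mult_right_mono[OF g(2)[of x], of "\<bar>?p x - prob A\<bar>"]
      by (simp flip: right_diff_distrib add: abs_mult)
  qed
  also have "\<dots> = T * (\<integral>x. \<bar>?p x - prob A\<bar> \<partial>M)" by simp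
  also have "\<dots> \<le> T * beta_coef M \<A> \<B>"
    using beta_coef_bounds(3)[OF \<A> \<B> A] T0 by (intro mult_left_mono) auto
  finally show ?thesis .
qed

lemma (in prob_space) cov_bounded_bound:
  assumes \<A>: "subalgebra M \<A>" and \<B>: "subalgebra M \<B>"
    and f: "f \<in> borel_measurable \<A>" "\<And>x. \<bar>f x\<bar> \<le> S"
    and g: "g \<in> borel_measurable \<B>" "\<And>x. \<bar>g x\<bar> \<le> T"
  shows "\<bar>(\<integral>x. f x * g x \<partial>M) - (\<integral>x. f x \<partial>M) * (\<integral>x. g x \<partial>M)\<bar> \<le> 2 * S * T * beta_coef M \<A> \<B>"
proof -
  interpret A: sigma_finite_subalgebra M \<A>
    using \<A> by (intro finite_measure_subalgebra_is_sigma_finite)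
      (simp add: finite_measure_subalgebra_def finite_measure_subalgebra_axioms_def finite_measure_axioms)
  have [measurable]: "f \<in> borel_measurable M" "g \<in> borel_measurable M"
    using measurable_from_subalg f(1) g(1) \<A> \<B> by auto
  have S0: "0 \<le> S" using f(2)[of undefined] by linarith
  let ?h = "real_cond_exp M \<A> g" and ?m = "\<integral>x. g x \<partial>M"
  have ig: "integrable M g"
    using integrable_bounded_mult(1)[where f=g and g=g, OF _ _ g(2) g(2)] by simp
  have ifg: "integrable M (\<lambda>x. f x * g x)" and "integrable M f"
    using integrable_bounded_mult[where f=f and g=g, OF _ _ f(2) g(2)] by simp_all
  have 1: "integrable M (\<lambda>x. f x * ?h x)" "(\<integral>x. f x * ?h x \<partial>M) = (\<integral>x. f x * g x \<partial>M)"
    using A.real_cond_exp_intg[OF ifg f(1)] by auto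
  define P where "P = {x\<in>space M. ?h x \<ge> ?m}"
  define N where "N = {x\<in>space M. ?h x < ?m}"
  have sp: "space M = space \<A>" using \<A> by (auto simp: subalgebra_def)
  have [measurable]: "?h \<in> borel_measurable \<A>" by simp
  have PA: "P \<in> sets \<A>" "N \<in> sets \<A>"
    unfolding P_def N_def sp by measurable
  have ind: "(\<integral>x. indicator Q x * (?h x - ?m) \<partial>M) = (\<integral>x. indicator Q x * g x \<partial>M) - prob Q * ?m"
    "integrable M (\<lambda>x. indicator Q x * (?h x - ?m))"
    if Q: "Q \<in> sets \<A>" for Q
  proof -
    have QM: "Q \<in> sets M" using Q \<A> by (auto simp: subalgebra_def)
    have i: "integrable M (\<lambda>x. indicator Q x * g x)"
      using integrable_bounded_mult(2)[of "indicator Q" g 1 T] g(2) QM by (auto simp: indicator_def)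
    have 2: "integrable M (\<lambda>x. indicator Q x * ?h x)"
        "(\<integral>x. indicator Q x * ?h x \<partial>M) = (\<integral>x. indicator Q x * g x \<partial>M)"
      using A.real_cond_exp_intg[OF i] Q by auto
    have 3: "integrable M (indicator Q :: 'a \<Rightarrow> real)" using QM by (simp add: emeasure_eq_measure)
    have 4: "indicator Q x * (?h x - ?m) = indicator Q x * ?h x - indicator Q x * ?m" for x
      by (rule right_diff_distrib)
    have 5: "integrable M (\<lambda>x. indicator Q x * ?m)" "(\<integral>x. indicator Q x * ?m \<partial>M) = prob Q * ?m"
      using 3 QM by auto
    show "(\<integral>x. indicator Q x * (?h x - ?m) \<partial>M) = (\<integral>x. indicator Q x * g x \<partial>M) - prob Q * ?m"
      "integrable M (\<lambda>x. indicator Q x * (?h x - ?m))"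
      unfolding 4 using Bochner_Integration.integral_diff[OF 2(1) 5(1)] 2 5
      by (simp_all only: Bochner_Integration.integrable_diff)
  qed
  have "(\<integral>x. f x * g x \<partial>M) - (\<integral>x. f x \<partial>M) * ?m = (\<integral>x. f x * ?h x - f x * ?m \<partial>M)"
    using 1 \<open>integrable M f\<close> by simp
  also have "\<bar>\<dots>\<bar> \<le> (\<integral>x. \<bar>f x * ?h x - f x * ?m\<bar> \<partial>M)"
    by (rule integral_abs_bound)
  also have "\<dots> \<le> (\<integral>x. S * (indicator P x * (?h x - ?m) - indicator N x * (?h x - ?m)) \<partial>M)"
  proof (rule integral_mono)
    show "integrable M (\<lambda>x. \<bar>f x * ?h x - f x * ?m\<bar>)" using 1 \<open>integrable M f\<close> by auto
    show "integrable M (\<lambda>x. S * (indicator P x * (?h x - ?m) - indicator N x * (?h x - ?m)))"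
      using ind(2)[OF PA(1)] ind(2)[OF PA(2)] by auto
    fix x assume "x \<in> space M"
    then have "indicator P x * (?h x - ?m) - indicator N x * (?h x - ?m) = \<bar>?h x - ?m\<bar>"
      by (auto simp: P_def N_def indicator_def)
    then show "\<bar>f x * ?h x - f x * ?m\<bar> \<le> S * (indicator P x * (?h x - ?m) - indicator N x * (?h x - ?m))"
      using mult_right_mono[OF f(2)[of x], of "\<bar>?h x - ?m\<bar>"]
      by (simp flip: right_diff_distrib add: abs_mult)
  qed
  also have "\<dots> = S * (((\<integral>x. indicator P x * g x \<partial>M) - prob P * ?m) - ((\<integral>x. indicator N x * g x \<partial>M) - prob N * ?m))"
    using ind[OF PA(1)] ind[OF PA(2)] by simp
  also have "\<dots> \<le> S * (2 * T * beta_coef M \<A> \<B>)"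
    using cov_indicator_bound[OF \<A> \<B> PA(1) g] cov_indicator_bound[OF \<A> \<B> PA(2) g] S0
    by (intro mult_left_mono) linarith+
  finally show ?thesis by (simp add: mult_ac)
qed

subsection \<open>Covariance inequalities under mixing\<close>

lemma truncated_product_bound:
  fixes a b T p :: real
  assumes T: "0 < T" and p: "2 \<le> p"
  defines "t \<equiv> \<lambda>x. if \<bar>x\<bar> \<le> T then x else 0"
  shows "\<bar>a * b - t a * t b\<bar> \<le> T powr (2 - p) * (\<bar>a\<bar> powr p + \<bar>b\<bar> powr p)"
proof (cases "\<bar>a\<bar> \<le> T \<and> \<bar>b\<bar> \<le> T")
  case True
  then show ?thesis by (simp add: t_def)
next
  case False
  define m where "m = max \<bar>a\<bar> \<bar>b\<bar>"
  have m: "T < m" using False by (auto simp: m_def)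
  have "\<bar>a * b - t a * t b\<bar> = \<bar>a\<bar> * \<bar>b\<bar>"
    using False by (auto simp: t_def abs_mult)
  also have "\<dots> \<le> m * m"
    by (intro mult_mono) (auto simp: m_def)
  also have "\<dots> = m powr 2"
    using m T by (simp add: power2_eq_square)
  also have "\<dots> = m powr (2 - p) * m powr p"
    by (simp flip: powr_add)
  also have "\<dots> \<le> T powr (2 - p) * m powr p"
    using m T p by (intro mult_right_mono powr_mono2') auto
  also have "m powr p \<le> \<bar>a\<bar> powr p + \<bar>b\<bar> powr p"
    by (auto simp: m_def max_def)
  finally show ?thesis by (simp add: mult_left_mono)
qed

context prob_space
begin

lemma integrable_of_powr:
  fixes f :: "'a \<Rightarrow> real"
  assumes "f \<in> borel_measurable M" "1 \<le> p" "integrable M (\<lambda>x. \<bar>f x\<bar> powr p)"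
  shows "integrable M f"
proof (rule Bochner_Integration.integrable_bound)
  show "integrable M (\<lambda>x. 1 + \<bar>f x\<bar> powr p)" using assms(3) by auto
  show "AE x in M. norm (f x) \<le> norm (1 + \<bar>f x\<bar> powr p)"
  proof (rule AE_I2)
    fix x
    have "\<bar>f x\<bar> \<le> 1 + \<bar>f x\<bar> powr p"
    proof (cases "\<bar>f x\<bar> \<le> 1")
      case True
      then show ?thesis by (meson add_increasing2 powr_ge_zero)
    next
      case False
      then show ?thesis using powr_mono[of 1 p "\<bar>f x\<bar>"] assms(2) by simp
    qed
    then show "norm (f x) \<le> norm (1 + \<bar>f x\<bar> powr p)" by simp
  qed
qed (use assms in auto)

lemma integrable_mult_of_powr:
  fixes f g :: "'a \<Rightarrow> real"
  assumes "f \<in> borel_measurable M" "g \<in> borel_measurable M" "2 \<le> p"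
    "integrable M (\<lambda>x. \<bar>f x\<bar> powr p)" "integrable M (\<lambda>x. \<bar>g x\<bar> powr p)"
  shows "integrable M (\<lambda>x. f x * g x)"
proof (rule Bochner_Integration.integrable_bound)
  show "integrable M (\<lambda>x. 1 + (\<bar>f x\<bar> powr p + \<bar>g x\<bar> powr p))" using assms by auto
  show "AE x in M. norm (f x * g x) \<le> norm (1 + (\<bar>f x\<bar> powr p + \<bar>g x\<bar> powr p))"
  proof (rule AE_I2)
    fix x
    let ?t = "\<lambda>x::real. if \<bar>x\<bar> \<le> 1 then x else 0"
    have "\<bar>f x * g x - ?t (f x) * ?t (g x)\<bar> \<le> \<bar>f x\<bar> powr p + \<bar>g x\<bar> powr p"
      using truncated_product_bound[of 1 p "f x" "g x"] assms(3) by simp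
    moreover have "\<bar>?t (f x) * ?t (g x)\<bar> \<le> 1"
      unfolding abs_mult by (intro mult_le_one) auto
    ultimately have "\<bar>f x * g x\<bar> \<le> 1 + (\<bar>f x\<bar> powr p + \<bar>g x\<bar> powr p)" by linarith
    then show "norm (f x * g x) \<le> norm (1 + (\<bar>f x\<bar> powr p + \<bar>g x\<bar> powr p))" by simp
  qed
qed (use assms in auto)

lemma cov_truncation_bound:
  fixes f g :: "'a \<Rightarrow> real"
  assumes \<A>: "subalgebra M \<A>" and \<B>: "subalgebra M \<B>"
    and f: "f \<in> borel_measurable \<A>" and g: "g \<in> borel_measurable \<B>"
    and p: "2 \<le> p" and T: "0 < T"
    and fi: "integrable M (\<lambda>x. \<bar>f x\<bar> powr p)" "(\<integral>x. \<bar>f x\<bar> powr p \<partial>M) \<le> K"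
    and gi: "integrable M (\<lambda>x. \<bar>g x\<bar> powr p)" "(\<integral>x. \<bar>g x\<bar> powr p \<partial>M) \<le> K"
  shows "\<bar>(\<integral>x. f x * g x \<partial>M) - (\<integral>x. f x \<partial>M) * (\<integral>x. g x \<partial>M)\<bar>
    \<le> 2 * T\<^sup>2 * beta_coef M \<A> \<B> + 4 * K * T powr (2 - p)"
proof -
  define t where "t x = (if \<bar>x\<bar> \<le> T then x else 0)" for x :: real
  have t_meas[measurable]: "t \<in> borel_measurable borel"
    unfolding t_def by measurable
  have tT: "\<bar>t x\<bar> \<le> T" for x using T by (auto simp: t_def)
  have point: "\<bar>a * b - t a * t b\<bar> \<le> T powr (2 - p) * (\<bar>a\<bar> powr p + \<bar>b\<bar> powr p)" for a b
    using truncated_product_bound[OF T p] unfolding t_def by simp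
  have fM[measurable]: "f \<in> borel_measurable M" "g \<in> borel_measurable M"
    using measurable_from_subalg f(1) g(1) \<A> \<B> by auto
  let ?c = "T powr (2 - p)"
  have c0: "0 \<le> ?c" by simp
  have if_: "integrable M f" "integrable M g"
    using integrable_of_powr[OF fM(1) _ fi(1)] integrable_of_powr[OF fM(2) _ gi(1)] p by simp_all
  have ifg: "integrable M (\<lambda>x. f x * g x)"
    by (rule integrable_mult_of_powr[OF fM p fi(1) gi(1)])
  have tf: "(\<lambda>x. t (f x)) \<in> borel_measurable M" and tg: "(\<lambda>x. t (g x)) \<in> borel_measurable M"
    by measurable
  have it: "integrable M (\<lambda>x. t (f x))" "integrable M (\<lambda>x. t (g x))"
      "integrable M (\<lambda>x. t (f x) * t (g x))"
    using integrable_bounded_mult[OF tf tg tT tT] integrable_bounded_mult(1)[OF tg tg tT tT] by simp_all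
  have joint: "\<bar>(\<integral>x. f x * g x \<partial>M) - (\<integral>x. t (f x) * t (g x) \<partial>M)\<bar> \<le> ?c * (2 * K)"
  proof -
    have "(\<integral>x. f x * g x \<partial>M) - (\<integral>x. t (f x) * t (g x) \<partial>M) = (\<integral>x. f x * g x - t (f x) * t (g x) \<partial>M)"
      using ifg it by simp
    also have "\<bar>\<dots>\<bar> \<le> (\<integral>x. \<bar>f x * g x - t (f x) * t (g x)\<bar> \<partial>M)"
      by (rule integral_abs_bound)
    also have "\<dots> \<le> (\<integral>x. ?c * (\<bar>f x\<bar> powr p + \<bar>g x\<bar> powr p) \<partial>M)"
      by (intro integral_mono point) (use ifg it fi gi in auto)
    also have "\<dots> = ?c * ((\<integral>x. \<bar>f x\<bar> powr p \<partial>M) + (\<integral>x. \<bar>g x\<bar> powr p \<partial>M))"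
      using fi gi by simp
    also have "\<dots> \<le> ?c * (2 * K)"
      using fi gi c0 by (intro mult_left_mono) auto
    finally show ?thesis .
  qed
  \<comment> \<open>The product of the means is handled by integrating the same pointwise bound over two
    independent arguments, one after the other.\<close>
  have half: "\<bar>f x * (\<integral>y. g y \<partial>M) - t (f x) * (\<integral>y. t (g y) \<partial>M)\<bar> \<le> ?c * (\<bar>f x\<bar> powr p + K)" for x
  proof -
    have "f x * (\<integral>y. g y \<partial>M) - t (f x) * (\<integral>y. t (g y) \<partial>M) = (\<integral>y. f x * g y - t (f x) * t (g y) \<partial>M)"
      using if_ it by simp
    also have "\<bar>\<dots>\<bar> \<le> (\<integral>y. \<bar>f x * g y - t (f x) * t (g y)\<bar> \<partial>M)"
      by (rule integral_abs_bound)
    also have "\<dots> \<le> (\<integral>y. ?c * (\<bar>f x\<bar> powr p + \<bar>g y\<bar> powr p) \<partial>M)"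
      by (intro integral_mono point) (use if_ it fi gi in auto)
    also have "\<dots> = ?c * (\<bar>f x\<bar> powr p + (\<integral>y. \<bar>g y\<bar> powr p \<partial>M))"
      using gi by (simp add: prob_space)
    also have "\<dots> \<le> ?c * (\<bar>f x\<bar> powr p + K)"
      using gi c0 by (intro mult_left_mono) auto
    finally show ?thesis .
  qed
  have prod: "\<bar>(\<integral>x. f x \<partial>M) * (\<integral>y. g y \<partial>M) - (\<integral>x. t (f x) \<partial>M) * (\<integral>y. t (g y) \<partial>M)\<bar> \<le> ?c * (2 * K)"
  proof -
    have "(\<integral>x. f x \<partial>M) * (\<integral>y. g y \<partial>M) - (\<integral>x. t (f x) \<partial>M) * (\<integral>y. t (g y) \<partial>M)
        = (\<integral>x. f x * (\<integral>y. g y \<partial>M) - t (f x) * (\<integral>y. t (g y) \<partial>M) \<partial>M)"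
      using if_ it by simp
    also have "\<bar>\<dots>\<bar> \<le> (\<integral>x. \<bar>f x * (\<integral>y. g y \<partial>M) - t (f x) * (\<integral>y. t (g y) \<partial>M)\<bar> \<partial>M)"
      by (rule integral_abs_bound)
    also have "\<dots> \<le> (\<integral>x. ?c * (\<bar>f x\<bar> powr p + K) \<partial>M)"
      by (intro integral_mono half) (use if_ it fi in auto)
    also have "\<dots> = ?c * ((\<integral>x. \<bar>f x\<bar> powr p \<partial>M) + K)"
      using fi by (simp add: prob_space)
    also have "\<dots> \<le> ?c * (2 * K)"
      using fi c0 by (intro mult_left_mono) auto
    finally show ?thesis .
  qed
  have "\<bar>(\<integral>x. t (f x) * t (g x) \<partial>M) - (\<integral>x. t (f x) \<partial>M) * (\<integral>x. t (g x) \<partial>M)\<bar>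
      \<le> 2 * T * T * beta_coef M \<A> \<B>"
    using f g by (intro cov_bounded_bound \<A> \<B> tT) auto
  with joint prod show ?thesis
    by (simp add: power2_eq_square algebra_simps abs_le_iff)
qed

text \<open>The truncation level \<open>b powr (-1/p)\<close> balances the two error terms; \<open>b\<close> is kept above the
  mixing coefficient because the latter may vanish.\<close>

lemma cov_mixing_bound:
  fixes f g :: "'a \<Rightarrow> real"
  assumes \<A>: "subalgebra M \<A>" and \<B>: "subalgebra M \<B>"
    and f: "f \<in> borel_measurable \<A>" and g: "g \<in> borel_measurable \<B>"
    and p: "2 < p" and b: "beta_coef M \<A> \<B> \<le> b"
    and fi: "integrable M (\<lambda>x. \<bar>f x\<bar> powr p)" "(\<integral>x. \<bar>f x\<bar> powr p \<partial>M) \<le> K"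
    and gi: "integrable M (\<lambda>x. \<bar>g x\<bar> powr p)" "(\<integral>x. \<bar>g x\<bar> powr p \<partial>M) \<le> K"
  shows "\<bar>(\<integral>x. f x * g x \<partial>M) - (\<integral>x. f x \<partial>M) * (\<integral>x. g x \<partial>M)\<bar> \<le> (2 + 4 * K) * b powr ((p - 2) / p)"
    (is "?L \<le> ?R b")
proof -
  have pos: "?L \<le> ?R c" if c: "0 < c" "beta_coef M \<A> \<B> \<le> c" for c
  proof -
    define T where "T = c powr (- 1 / p)"
    have T: "0 < T" using c by (simp add: T_def)
    have 1: "T powr (2 - p) = c powr ((p - 2) / p)"
    proof -
      have "- 1 / p * (2 - p) = (p - 2) / p" using p by (simp add: field_simps)
      then show ?thesis unfolding T_def powr_powr by (rule arg_cong)
    qed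
    have "T\<^sup>2 * beta_coef M \<A> \<B> \<le> T\<^sup>2 * c"
      using c by (intro mult_left_mono) auto
    also have "T\<^sup>2 = T powr 2" using T by simp
    also have "T powr 2 * c = c powr (- 2 / p) * c powr 1"
      using c(1) by (simp add: T_def powr_powr)
    also have "\<dots> = c powr ((p - 2) / p)"
    proof -
      have "- 2 / p + 1 = (p - 2) / p" using p by (simp add: field_simps)
      then show ?thesis unfolding powr_add[symmetric] by (rule arg_cong)
    qed
    finally have "2 * T\<^sup>2 * beta_coef M \<A> \<B> + 4 * K * T powr (2 - p) \<le> ?R c"
      unfolding 1 using T by (simp add: algebra_simps)
    moreover have "?L \<le> 2 * T\<^sup>2 * beta_coef M \<A> \<B> + 4 * K * T powr (2 - p)"
      by (rule cov_truncation_bound[OF \<A> \<B> f g _ T fi gi]) (use p in simp)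
    ultimately show ?thesis by linarith
  qed
  have b0: "0 \<le> b" using beta_coef_bounds(1)[OF \<A> \<B>] b by linarith
  show ?thesis
  proof (cases "b = 0")
    case True
    have "((\<lambda>c. ?R c) \<longlongrightarrow> (2 + 4 * K) * 0) (at_right 0)"
    proof (rule tendsto_mult_left)
      have "((\<lambda>c::real. c powr ((p - 2) / p)) \<longlongrightarrow> 0 powr ((p - 2) / p)) (at_right 0)"
        using p by (intro tendsto_powr2 tendsto_intros) (auto simp: eventually_at_filter)
      then show "((\<lambda>c::real. c powr ((p - 2) / p)) \<longlongrightarrow> 0) (at_right 0)" by simp
    qed
    moreover have "\<forall>\<^sub>F c in at_right 0. ?L \<le> ?R c"
      using eventually_at_right_less[of 0]
    proof eventually_elim
      case (elim c)
      then show ?case using b True by (intro pos) auto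
    qed
    ultimately have "?L \<le> (2 + 4 * K) * 0"
      by (rule tendsto_lowerbound) simp
    then show ?thesis by (simp add: True)
  next
    case False
    then show ?thesis using b b0 by (intro pos) auto
  qed
qed

lemma subalgebra_gen_sigma:
  assumes "\<And>i. Y i \<in> borel_measurable M"
  shows "subalgebra M (gen_sigma M Y I)"
proof -
  have "(\<Union>i\<in>I. {Y i -` B \<inter> space M | B. B \<in> sets borel}) \<subseteq> sets M"
    using assms by (auto simp: measurable_sets)
  moreover from this have "(\<Union>i\<in>I. {Y i -` B \<inter> space M | B. B \<in> sets borel}) \<subseteq> Pow (space M)"
    using sets.space_closed by (rule subset_trans)
  ultimately show ?thesis
    unfolding subalgebra_def gen_sigma_def
    by (simp add: sets_measure_of space_measure_of sets.sigma_sets_subset)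
qed

lemma measurable_gen_sigma:
  fixes Y :: "nat \<Rightarrow> 'a \<Rightarrow> real"
  assumes "i \<in> I"
  shows "Y i \<in> borel_measurable (gen_sigma M Y I)"
proof (rule measurableI)
  fix B :: "real set" assume "B \<in> sets borel"
  then have "Y i -` B \<inter> space M \<in> (\<Union>i\<in>I. {Y i -` B \<inter> space M | B. B \<in> sets borel})"
    using assms by blast
  moreover have "(\<Union>i\<in>I. {Y i -` B \<inter> space M | B. B \<in> sets borel}) \<subseteq> Pow (space M)" by auto
  ultimately show "Y i -` B \<inter> space (gen_sigma M Y I) \<in> sets (gen_sigma M Y I)"
    unfolding gen_sigma_def by (simp add: space_measure_of)
qed simp

lemma beta_coef_le_beta_proc:
  assumes Y: "\<And>i. Y i \<in> borel_measurable M" and "1 \<le> m"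
  shows "beta_coef M (gen_sigma M Y {1..m}) (gen_sigma M Y {k + m..}) \<le> beta_proc M Y k"
  unfolding beta_proc_def
  using assms(2) beta_coef_bounds(2)[OF subalgebra_gen_sigma subalgebra_gen_sigma, OF Y Y]
  by (intro cSUP_upper bdd_aboveI[of _ 1]) auto

lemma stationary_marginal:
  assumes stat: "strictly_stationary M Y" and Y: "\<And>i. Y i \<in> borel_measurable M" and i: "1 \<le> i"
  shows "distr M borel (Y i) = distr M borel (Y 1)"
proof -
  let ?P = "PiM {1..1::nat} (\<lambda>_. borel :: real measure)"
  have [measurable]: "Y i \<in> borel_measurable M" for i by (rule Y)
  have "distr (distr M ?P (\<lambda>\<omega>. \<lambda>j\<in>{1..1}. Y (j + (i - 1)) \<omega>)) borel (\<lambda>x. x 1)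
      = distr (distr M ?P (\<lambda>\<omega>. \<lambda>j\<in>{1..1}. Y j \<omega>)) borel (\<lambda>x. x 1)"
    using stat unfolding strictly_stationary_def by metis
  then show ?thesis
    using i by (subst (asm) (1 2) distr_distr) (auto simp: o_def)
qed

lemma stationary_integral:
  fixes f :: "real \<Rightarrow> real"
  assumes "strictly_stationary M Y" and Y: "\<And>i. Y i \<in> borel_measurable M" and "1 \<le> i"
    and f: "f \<in> borel_measurable borel"
  shows "(\<integral>\<omega>. f (Y i \<omega>) \<partial>M) = (\<integral>\<omega>. f (Y 1 \<omega>) \<partial>M)"
    and "integrable M (\<lambda>\<omega>. f (Y i \<omega>)) \<longleftrightarrow> integrable M (\<lambda>\<omega>. f (Y 1 \<omega>))"
  using stationary_marginal[OF assms(1-3)] integral_distr[OF Y f] integrable_distr_eq[OF Y f]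
  by metis+

lemma stationary_cov_bound:
  fixes f :: "real \<Rightarrow> real"
  assumes stat: "strictly_stationary M Y" and Y: "\<And>i. Y i \<in> borel_measurable M"
    and f: "f \<in> borel_measurable borel" and \<theta>: "0 < \<theta>"
    and fi: "integrable M (\<lambda>\<omega>. \<bar>f (Y 1 \<omega>)\<bar> powr (2 + \<theta>))"
    and i: "1 \<le> i"
  shows "\<bar>(\<integral>\<omega>. f (Y i \<omega>) * f (Y (k + i) \<omega>) \<partial>M) - (\<integral>\<omega>. f (Y 1 \<omega>) \<partial>M)\<^sup>2\<bar>
    \<le> (2 + 4 * (\<integral>\<omega>. \<bar>f (Y 1 \<omega>)\<bar> powr (2 + \<theta>) \<partial>M)) * beta_proc M Y k powr (\<theta> / (2 + \<theta>))"
proof -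
  let ?A = "gen_sigma M Y {1..i}" and ?B = "gen_sigma M Y {k + i..}"
  have mA: "(\<lambda>\<omega>. f (Y i \<omega>)) \<in> borel_measurable ?A"
    using measurable_compose[OF measurable_gen_sigma f] i by simp
  have mB: "(\<lambda>\<omega>. f (Y (k + i) \<omega>)) \<in> borel_measurable ?B"
    using measurable_compose[OF measurable_gen_sigma f] by simp
  have fp: "(\<lambda>x. \<bar>f x\<bar> powr (2 + \<theta>)) \<in> borel_measurable borel" using f by measurable
  note st = stationary_integral[OF stat Y _ fp]
  have ki: "1 \<le> k + i" using i by simp
  have "\<bar>(\<integral>\<omega>. f (Y i \<omega>) * f (Y (k + i) \<omega>) \<partial>M) - (\<integral>\<omega>. f (Y i \<omega>) \<partial>M) * (\<integral>\<omega>. f (Y (k + i) \<omega>) \<partial>M)\<bar>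
    \<le> (2 + 4 * (\<integral>\<omega>. \<bar>f (Y 1 \<omega>)\<bar> powr (2 + \<theta>) \<partial>M)) * beta_proc M Y k powr ((2 + \<theta> - 2) / (2 + \<theta>))"
    by (rule cov_mixing_bound[OF subalgebra_gen_sigma[OF Y] subalgebra_gen_sigma[OF Y] mA mB _
          beta_coef_le_beta_proc[OF Y i]])
      (use \<theta> fi st[OF i] st[OF ki] in auto)
  then show ?thesis
    by (simp add: stationary_integral(1)[OF stat Y i f] stationary_integral(1)[OF stat Y ki f] power2_eq_square)
qed

end

lemma sum_abs_diff_le_suminf:
  fixes c :: "nat \<Rightarrow> real"
  assumes c: "summable c" "\<And>k. 0 \<le> c k" and B: "finite B"
  shows "(\<Sum>r\<in>B. c (if r \<le> i then i - r else r - i)) \<le> 2 * suminf c"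
proof -
  have le: "(\<Sum>r\<in>S. c (h r)) \<le> suminf c" if "finite S" "inj_on h S" for S h
  proof -
    have "(\<Sum>r\<in>S. c (h r)) = sum c (h ` S)"
      using that by (simp add: sum.reindex)
    also have "\<dots> \<le> suminf c"
      using that c by (intro sum_le_suminf) auto
    finally show ?thesis .
  qed
  have "(\<Sum>r\<in>B. c (if r \<le> i then i - r else r - i))
      = (\<Sum>r\<in>{r\<in>B. r \<le> i}. c (i - r)) + (\<Sum>r\<in>{r\<in>B. \<not> r \<le> i}. c (r - i))"
    using B by (simp add: sum.If_cases if_distrib[of c] Int_def)
  also have "\<dots> \<le> suminf c + suminf c"
    using B by (intro add_mono le) (auto simp: inj_on_def)
  finally show ?thesis by simp
qed

lemma (in prob_space) weighted_sum_second_moment: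
  fixes f :: "real \<Rightarrow> real"
  assumes stat: "strictly_stationary M Y" and Y: "\<And>i. Y i \<in> borel_measurable M"
    and f: "f \<in> borel_measurable borel" and \<theta>: "0 < \<theta>"
    and fi: "integrable M (\<lambda>\<omega>. \<bar>f (Y 1 \<omega>)\<bar> powr (2 + \<theta>))"
    and mix: "summable (\<lambda>k. beta_proc M Y (Suc k) powr (\<theta> / (2 + \<theta>)))"
  defines "m \<equiv> \<integral>\<omega>. f (Y 1 \<omega>) \<partial>M"
  shows "\<exists>C. \<forall>B w W. finite B \<longrightarrow> B \<subseteq> {1..} \<longrightarrow> (\<forall>i\<in>B. \<bar>w i\<bar> \<le> W) \<longrightarrow>
      integrable M (\<lambda>\<omega>. (\<Sum>i\<in>B. w i * (f (Y i \<omega>) - m))\<^sup>2) \<and>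
      (\<integral>\<omega>. (\<Sum>i\<in>B. w i * (f (Y i \<omega>) - m))\<^sup>2 \<partial>M) \<le> C * W\<^sup>2 * real (card B)"
proof -
  define K where "K = (\<integral>\<omega>. \<bar>f (Y 1 \<omega>)\<bar> powr (2 + \<theta>) \<partial>M)"
  have K0: "0 \<le> K" unfolding K_def by (rule integral_nonneg_AE) simp
  define c where "c k = (2 + 4 * K) * beta_proc M Y k powr (\<theta> / (2 + \<theta>))" for k
  have "summable (\<lambda>k. beta_proc M Y k powr (\<theta> / (2 + \<theta>)))"
    using mix by (rule summable_Suc_iff[THEN iffD1])
  then have c: "summable c" "\<And>k. 0 \<le> c k"
    using K0 unfolding c_def by (auto intro!: summable_mult)
  have [measurable]: "Y i \<in> borel_measurable M" for i by (rule Y)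
  note [measurable] = f
  have fp: "(\<lambda>x. \<bar>f x\<bar> powr (2 + \<theta>)) \<in> borel_measurable borel" by measurable
  have fpi: "integrable M (\<lambda>\<omega>. \<bar>f (Y i \<omega>)\<bar> powr (2 + \<theta>))" if "1 \<le> i" for i
    using stationary_integral(2)[OF stat Y that fp] fi by simp
  have ff: "integrable M (\<lambda>\<omega>. f (Y i \<omega>) * f (Y r \<omega>))" if "1 \<le> i" "1 \<le> r" for i r
    by (rule integrable_mult_of_powr[OF _ _ _ fpi[OF that(1)] fpi[OF that(2)]]) (use \<theta> in auto)
  have f1: "integrable M (\<lambda>\<omega>. f (Y i \<omega>))" if "1 \<le> i" for i
    by (rule integrable_of_powr[OF _ _ fpi[OF that]]) (use \<theta> in auto)
  define g where "g i \<omega> = f (Y i \<omega>) - m" for i \<omega>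
  have gg: "g i \<omega> * g r \<omega> = f (Y i \<omega>) * f (Y r \<omega>) - m * f (Y i \<omega>) - m * f (Y r \<omega>) + m\<^sup>2" for i r \<omega>
    by (simp add: g_def algebra_simps power2_eq_square)
  have gi: "integrable M (\<lambda>\<omega>. g i \<omega> * g r \<omega>)" if "1 \<le> i" "1 \<le> r" for i r
    unfolding gg using ff[OF that] f1[OF that(1)] f1[OF that(2)] by auto
  have gE: "(\<integral>\<omega>. g i \<omega> * g r \<omega> \<partial>M) = (\<integral>\<omega>. f (Y i \<omega>) * f (Y r \<omega>) \<partial>M) - m\<^sup>2" if "1 \<le> i" "1 \<le> r" for i r
    unfolding gg using ff[OF that] f1[OF that(1)] f1[OF that(2)]
      stationary_integral(1)[OF stat Y that(1) f] stationary_integral(1)[OF stat Y that(2) f]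
    by (simp add: prob_space power2_eq_square m_def)
  have cov: "\<bar>\<integral>\<omega>. g i \<omega> * g r \<omega> \<partial>M\<bar> \<le> c (if r \<le> i then i - r else r - i)" if "1 \<le> i" "1 \<le> r" for i r
  proof (cases "r \<le> i")
    case True
    then have "\<bar>\<integral>\<omega>. g r \<omega> * g i \<omega> \<partial>M\<bar> \<le> c (i - r)"
      using stationary_cov_bound[OF stat Y f \<theta> fi that(2), of "i - r"] gE[OF that(2,1)] True
      by (simp add: c_def K_def m_def)
    with True show ?thesis by (simp add: mult.commute)
  next
    case False
    then show ?thesis
      using stationary_cov_bound[OF stat Y f \<theta> fi that(1), of "r - i"] gE[OF that]
      by (simp add: c_def K_def m_def)
  qed
  have "integrable M (\<lambda>\<omega>. (\<Sum>i\<in>B. w i * g i \<omega>)\<^sup>2) \<and>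
      (\<integral>\<omega>. (\<Sum>i\<in>B. w i * g i \<omega>)\<^sup>2 \<partial>M) \<le> 2 * suminf c * W\<^sup>2 * real (card B)"
    if B: "finite B" "B \<subseteq> {1..}" and w: "\<forall>i\<in>B. \<bar>w i\<bar> \<le> W" for B W and w :: "nat \<Rightarrow> real"
  proof
    have B1: "1 \<le> i" if "i \<in> B" for i using B that by auto
    have sq: "(\<Sum>i\<in>B. w i * g i \<omega>)\<^sup>2 = (\<Sum>i\<in>B. \<Sum>r\<in>B. w i * w r * (g i \<omega> * g r \<omega>))" for \<omega>
      by (simp add: power2_eq_square sum_product mult_ac)
    have i2: "integrable M (\<lambda>\<omega>. w i * w r * (g i \<omega> * g r \<omega>))" if "i \<in> B" "r \<in> B" for i r
      using gi[OF B1[OF that(1)] B1[OF that(2)]] by simp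
    show "integrable M (\<lambda>\<omega>. (\<Sum>i\<in>B. w i * g i \<omega>)\<^sup>2)"
      unfolding sq by (intro Bochner_Integration.integrable_sum i2)
    have "(\<integral>\<omega>. (\<Sum>i\<in>B. w i * g i \<omega>)\<^sup>2 \<partial>M) = (\<Sum>i\<in>B. \<integral>\<omega>. (\<Sum>r\<in>B. w i * w r * (g i \<omega> * g r \<omega>)) \<partial>M)"
      unfolding sq by (intro Bochner_Integration.integral_sum Bochner_Integration.integrable_sum i2)
    also have "\<dots> = (\<Sum>i\<in>B. \<Sum>r\<in>B. w i * w r * (\<integral>\<omega>. g i \<omega> * g r \<omega> \<partial>M))"
      by (intro sum.cong refl) (subst Bochner_Integration.integral_sum, auto intro: gi B1)
    also have "\<dots> \<le> (\<Sum>i\<in>B. \<Sum>r\<in>B. W\<^sup>2 * c (if r \<le> i then i - r else r - i))"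
    proof (intro sum_mono)
      fix i r assume ir: "i \<in> B" "r \<in> B"
      have W: "\<bar>w i\<bar> \<le> W" "\<bar>w r\<bar> \<le> W" using w ir by auto
      have "w i * w r * (\<integral>\<omega>. g i \<omega> * g r \<omega> \<partial>M) \<le> \<bar>w i\<bar> * \<bar>w r\<bar> * \<bar>\<integral>\<omega>. g i \<omega> * g r \<omega> \<partial>M\<bar>"
        by (metis abs_ge_self abs_mult)
      also have "\<dots> \<le> W * W * c (if r \<le> i then i - r else r - i)"
        using W B1 ir by (intro mult_mono cov) auto
      finally show "w i * w r * (\<integral>\<omega>. g i \<omega> * g r \<omega> \<partial>M) \<le> W\<^sup>2 * c (if r \<le> i then i - r else r - i)"
        by (simp add: power2_eq_square)
    qed
    also have "\<dots> \<le> (\<Sum>i\<in>B. W\<^sup>2 * (2 * suminf c))"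
    proof (rule sum_mono)
      fix i
      show "(\<Sum>r\<in>B. W\<^sup>2 * c (if r \<le> i then i - r else r - i)) \<le> W\<^sup>2 * (2 * suminf c)"
        unfolding sum_distrib_left[symmetric]
        using sum_abs_diff_le_suminf[OF c B(1)] by (rule mult_left_mono) simp
    qed
    finally show "(\<integral>\<omega>. (\<Sum>i\<in>B. w i * g i \<omega>)\<^sup>2 \<partial>M) \<le> 2 * suminf c * W\<^sup>2 * real (card B)"
      by (simp add: mult_ac)
  qed
  then show ?thesis unfolding g_def by blast
qed

subsection \<open>Blocks\<close>

lemma variance_of_sum_expansion:
  fixes x u :: "nat \<Rightarrow> real"
  assumes B: "finite B" and l: "real (card B) = l" "0 < l"
  defines "mx \<equiv> (1 / l) * (\<Sum>i\<in>B. x i)" and "mu \<equiv> (1 / l) * (\<Sum>i\<in>B. u i)"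
  shows "(1 / l) * (\<Sum>i\<in>B. (x i + u i - (1 / l) * (\<Sum>r\<in>B. x r + u r))\<^sup>2)
    = (1 / l) * (\<Sum>i\<in>B. (x i)\<^sup>2) - mx\<^sup>2 + 2 * ((1 / l) * (\<Sum>i\<in>B. (u i - mu) * x i))
      + (1 / l) * (\<Sum>i\<in>B. (u i - mu)\<^sup>2)"
proof -
  have sx: "(\<Sum>i\<in>B. x i) = l * mx" and su: "(\<Sum>i\<in>B. u i) = l * mu"
    using l by (simp_all add: mx_def mu_def)
  have m: "(1 / l) * (\<Sum>r\<in>B. x r + u r) = mx + mu"
    by (simp add: mx_def mu_def sum.distrib distrib_left)
  define v where "v i = u i - mu" for i
  have z: "(\<Sum>i\<in>B. v i) = 0"
    using l su by (simp add: v_def sum_subtractf)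
  have "(\<Sum>i\<in>B. (x i + u i - (mx + mu))\<^sup>2)
      = (\<Sum>i\<in>B. (x i)\<^sup>2 - 2 * mx * x i + mx\<^sup>2 + 2 * (v i * x i) - 2 * mx * v i + (v i)\<^sup>2)"
    by (intro sum.cong refl) (simp add: v_def power2_eq_square algebra_simps)
  also have "\<dots> = (\<Sum>i\<in>B. (x i)\<^sup>2) - 2 * mx * (\<Sum>i\<in>B. x i) + l * mx\<^sup>2
      + 2 * (\<Sum>i\<in>B. v i * x i) - 2 * mx * (\<Sum>i\<in>B. v i) + (\<Sum>i\<in>B. (v i)\<^sup>2)"
    using l by (simp add: sum.distrib sum_subtractf sum_distrib_left)
  also have "\<dots> = (\<Sum>i\<in>B. (x i)\<^sup>2) - l * mx\<^sup>2 + 2 * (\<Sum>i\<in>B. v i * x i) + (\<Sum>i\<in>B. (v i)\<^sup>2)"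
    unfolding z sx by (simp add: power2_eq_square)
  finally have eq: "(\<Sum>i\<in>B. (x i + u i - (mx + mu))\<^sup>2) = \<dots>" .
  show ?thesis
    unfolding m eq v_def[symmetric] using l by (simp add: distrib_left right_diff_distrib)
qed

lemma abs_ln_diff_le:
  fixes v w c :: real
  assumes "0 < c" "c \<le> v" "\<bar>w - v\<bar> \<le> c / 2"
  shows "\<bar>ln w - ln v\<bar> \<le> 2 * \<bar>w - v\<bar> / c"
proof -
  have w: "c / 2 \<le> w" using assms by linarith
  have "ln w - ln v \<le> (w - v) / v" using assms w by (intro ln_diff_le) auto
  also have "\<dots> \<le> \<bar>w - v\<bar> / (c / 2)" using assms by (intro frac_le) auto
  finally have 1: "ln w - ln v \<le> 2 * \<bar>w - v\<bar> / c" by (simp add: mult.commute)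
  have "ln v - ln w \<le> (v - w) / w" using assms w by (intro ln_diff_le) auto
  also have "\<dots> \<le> \<bar>w - v\<bar> / (c / 2)" using assms w by (intro frac_le) auto
  finally have 2: "ln v - ln w \<le> 2 * \<bar>w - v\<bar> / c" by (simp add: mult.commute)
  show ?thesis using 1 2 by linarith
qed

lemma abs_mean_diff_le:
  fixes u :: "nat \<Rightarrow> real"
  assumes B: "finite B" "B \<noteq> {}" and u: "\<And>r. r \<in> B \<Longrightarrow> \<bar>a - u r\<bar> \<le> d"
  shows "\<bar>a - (1 / real (card B)) * (\<Sum>r\<in>B. u r)\<bar> \<le> d"
proof -
  have c: "0 < real (card B)" using B by (simp add: card_gt_0_iff)
  then have "a - (1 / real (card B)) * (\<Sum>r\<in>B. u r) = (1 / real (card B)) * (\<Sum>r\<in>B. a - u r)"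
    by (simp add: sum_subtractf field_simps)
  also have "\<bar>\<dots>\<bar> = (1 / real (card B)) * \<bar>\<Sum>r\<in>B. a - u r\<bar>" by (simp add: abs_mult)
  also have "\<dots> \<le> (1 / real (card B)) * (\<Sum>r\<in>B. d)"
    using u by (intro mult_left_mono order.trans[OF sum_abs] sum_mono) auto
  also have "\<dots> = d" using c by simp
  finally show ?thesis .
qed

lemma mean_abs_difference_perturbation:
  fixes x y :: "nat \<Rightarrow> real"
  assumes b: "2 \<le> b" and xy: "\<And>j. j \<in> {1..b} \<Longrightarrow> \<bar>x j - y j\<bar> \<le> t"
  shows "\<bar>(1 / (real b * (real b - 1))) * (\<Sum>j\<in>{1..b}. \<Sum>k\<in>{1..b} - {j}. \<bar>x j - x k\<bar>)
       - (1 / (real b * (real b - 1))) * (\<Sum>j\<in>{1..b}. \<Sum>k\<in>{1..b} - {j}. \<bar>y j - y k\<bar>)\<bar> \<le> 2 * t"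
proof -
  define c where "c = real b * (real b - 1)"
  have c: "0 < c" using b by (simp add: c_def)
  have "\<bar>(\<Sum>j\<in>{1..b}. \<Sum>k\<in>{1..b} - {j}. \<bar>x j - x k\<bar>) - (\<Sum>j\<in>{1..b}. \<Sum>k\<in>{1..b} - {j}. \<bar>y j - y k\<bar>)\<bar>
      = \<bar>\<Sum>j\<in>{1..b}. \<Sum>k\<in>{1..b} - {j}. \<bar>x j - x k\<bar> - \<bar>y j - y k\<bar>\<bar>"
    by (simp add: sum_subtractf)
  also have "\<dots> \<le> (\<Sum>j\<in>{1..b}. \<Sum>k\<in>{1..b} - {j}. 2 * t)"
  proof (intro order.trans[OF sum_abs] sum_mono)
    fix j k assume "j \<in> {1..b}" "k \<in> {1..b} - {j}"
    then show "\<bar>\<bar>x j - x k\<bar> - \<bar>y j - y k\<bar>\<bar> \<le> 2 * t"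
      using xy[of j] xy[of k] by (simp add: abs_le_iff) linarith
  qed
  also have "\<dots> = (\<Sum>j\<in>{1..b}. (real b - 1) * (2 * t))"
    using b by (intro sum.cong refl) (simp add: card_Diff_singleton of_nat_diff)
  also have "\<dots> = c * (2 * t)" by (simp add: c_def)
  finally have "\<bar>(1 / c) * ((\<Sum>j\<in>{1..b}. \<Sum>k\<in>{1..b} - {j}. \<bar>x j - x k\<bar>)
      - (\<Sum>j\<in>{1..b}. \<Sum>k\<in>{1..b} - {j}. \<bar>y j - y k\<bar>))\<bar> \<le> (1 / c) * (c * (2 * t))"
    unfolding abs_mult using c by (intro mult_mono) auto
  then show ?thesis unfolding c_def[symmetric] using c by (simp add: right_diff_distrib)
qed

lemma block_index_bounds:
  fixes l b j i :: nat
  assumes "1 \<le> j" "j \<le> b" "i \<in> {(j - 1) * l + 1..j * l}"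
  shows "1 \<le> i" "i \<le> l * b" "real i \<le> real j * real l" "(real j - 1) * real l \<le> real i"
proof -
  show "1 \<le> i" using assms by simp
  have "i \<le> j * l" using assms by simp
  also have "\<dots> \<le> b * l" using assms by simp
  finally show "i \<le> l * b" by (simp add: mult.commute)
  show "real i \<le> real j * real l"
    using assms by (simp flip: of_nat_mult)
  have "(j - 1) * l \<le> i" using assms by simp
  then have "real ((j - 1) * l) \<le> real i" by (rule of_nat_mono)
  then show "(real j - 1) * real l \<le> real i" using assms by (simp add: of_nat_diff)
qed

lemma block_card:
  fixes j l :: nat
  assumes "1 \<le> j"
  shows "card {(j - 1) * l + 1..j * l} = l"
proof -
  have "j * l = (j - 1) * l + l" using assms by (cases j) auto
  then show ?thesis by simp
qed

lemma admissible_blocks: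
  assumes "n \<in> admissible_n s" "1 \<le> n"
  shows "real (blen s n) = real n powr s" "real (bnum s n) = real n powr (1 - s)"
    "n = blen s n * bnum s n"
proof -
  from assms obtain m q where m: "real n powr s = real m" and q: "real n / real n powr s = real q"
    by (auto simp: admissible_n_def Nats_def)
  have m0: "0 < real m" using m assms by (metis gr_zeroI less_irrefl of_nat_0 of_nat_0_less_iff powr_gt_zero zero_less_one_class.zero_le_one not_one_le_zero)
  show bl: "real (blen s n) = real n powr s" by (simp add: blen_def m)
  then have bm: "blen s n = m" using m by simp
  have "real n = real m * real q" using q m m0 by (simp add: field_simps)
  then have nmq: "n = m * q" by (metis of_nat_eq_iff of_nat_mult)
  then have bq: "bnum s n = q" unfolding bnum_def bm using m0 by simp
  show "n = blen s n * bnum s n" using nmq bm bq by simp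
  show "real (bnum s n) = real n powr (1 - s)"
    using q bq assms by (simp add: powr_diff)
qed

lemma (in prob_space) block_tail_bound:
  fixes S :: "nat \<Rightarrow> 'a \<Rightarrow> real"
  assumes S: "\<And>j. j \<in> {1..b} \<Longrightarrow> S j \<in> borel_measurable M"
    and Si: "\<And>j. j \<in> {1..b} \<Longrightarrow> integrable M (\<lambda>\<omega>. (S j \<omega>)\<^sup>2)"
    and SK: "\<And>j. j \<in> {1..b} \<Longrightarrow> (\<integral>\<omega>. (S j \<omega>)\<^sup>2 \<partial>M) \<le> K * l"
    and l: "0 < l" and d: "0 < d"
  shows "prob (\<Union>j\<in>{1..b}. {\<omega>\<in>space M. d * l \<le> \<bar>S j \<omega>\<bar>}) \<le> K / d\<^sup>2 * (real b / l)"
proof -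
  have "prob (\<Union>j\<in>{1..b}. {\<omega>\<in>space M. d * l \<le> \<bar>S j \<omega>\<bar>}) \<le> (\<Sum>j\<in>{1..b}. prob {\<omega>\<in>space M. d * l \<le> \<bar>S j \<omega>\<bar>})"
    using S by (intro finite_measure_subadditive_finite) auto
  also have "\<dots> \<le> (\<Sum>j\<in>{1..b}. K * l / (d * l)\<^sup>2)"
  proof (rule sum_mono)
    fix j assume j: "j \<in> {1..b}"
    have "prob {\<omega>\<in>space M. d * l \<le> \<bar>S j \<omega>\<bar>} \<le> (\<integral>\<omega>. (S j \<omega>)\<^sup>2 \<partial>M) / (d * l)\<^sup>2"
      using S[OF j] Si[OF j] l d by (intro second_moment_method) auto
    also have "\<dots> \<le> K * l / (d * l)\<^sup>2"
      using SK[OF j] by (intro divide_right_mono) auto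
    finally show "prob {\<omega>\<in>space M. d * l \<le> \<bar>S j \<omega>\<bar>} \<le> K * l / (d * l)\<^sup>2" .
  qed
  also have "\<dots> = K / d\<^sup>2 * (real b / l)"
    using l d by (simp add: power2_eq_square field_simps)
  finally show ?thesis .
qed

subsection \<open>Cadlag functions and step functions\<close>

lemma cadlag01_oscillation:
  assumes f: "cadlag01 f" and x: "x \<in> {0..1}" and e: "0 < e"
  shows "\<exists>d>0. (\<forall>y\<in>{x-d<..<x} \<inter> {0..1}. \<forall>z\<in>{x-d<..<x} \<inter> {0..1}. \<bar>f y - f z\<bar> < e) \<and>
               (\<forall>y\<in>{x<..<x+d} \<inter> {0..1}. \<forall>z\<in>{x<..<x+d} \<inter> {0..1}. \<bar>f y - f z\<bar> < e)"
proof -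
  have left: "\<exists>d>0. \<forall>y\<in>{x-d<..<x} \<inter> {0..1}. \<forall>z\<in>{x-d<..<x} \<inter> {0..1}. \<bar>f y - f z\<bar> < e"
  proof (cases "x = 0")
    case True
    then show ?thesis by (intro exI[of _ 1]) auto
  next
    case False
    with x have "x \<in> {0<..1}" by auto
    then obtain L where "(f \<longlongrightarrow> L) (at_left x)"
      using f unfolding cadlag01_def by blast
    then have "\<forall>\<^sub>F y in at_left x. dist (f y) L < e / 2"
      using e by (intro tendstoD) auto
    then obtain c where c: "c < x" "\<And>y. c < y \<Longrightarrow> y < x \<Longrightarrow> \<bar>f y - L\<bar> < e / 2"
      by (subst (asm) eventually_at_left[of "x - 1"]) (auto simp: dist_real_def)
    show ?thesis
    proof (intro exI[of _ "x - c"] conjI ballI)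
      fix y z assume "y \<in> {x - (x - c)<..<x} \<inter> {0..1}" "z \<in> {x - (x - c)<..<x} \<inter> {0..1}"
      then have "\<bar>f y - L\<bar> < e / 2" "\<bar>f z - L\<bar> < e / 2"
        using c(2)[of y] c(2)[of z] by auto
      then show "\<bar>f y - f z\<bar> < e" by linarith
    qed (use c in auto)
  qed
  have right: "\<exists>d>0. \<forall>y\<in>{x<..<x+d} \<inter> {0..1}. \<forall>z\<in>{x<..<x+d} \<inter> {0..1}. \<bar>f y - f z\<bar> < e"
  proof (cases "x = 1")
    case True
    then show ?thesis by (intro exI[of _ 1]) auto
  next
    case False
    with x have "x \<in> {0..<1}" by auto
    then have "(f \<longlongrightarrow> f x) (at_right x)"
      using f by (auto simp: cadlag01_def continuous_within)
    then have "\<forall>\<^sub>F y in at_right x. dist (f y) (f x) < e / 2"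
      using e by (intro tendstoD) auto
    then obtain c where c: "c > x" "\<And>y. x < y \<Longrightarrow> y < c \<Longrightarrow> \<bar>f y - f x\<bar> < e / 2"
      by (subst (asm) eventually_at_right[of _ "x + 1"]) (auto simp: dist_real_def)
    show ?thesis
    proof (intro exI[of _ "c - x"] conjI ballI)
      fix y z assume "y \<in> {x<..<x + (c - x)} \<inter> {0..1}" "z \<in> {x<..<x + (c - x)} \<inter> {0..1}"
      then have "\<bar>f y - f x\<bar> < e / 2" "\<bar>f z - f x\<bar> < e / 2"
        using c(2)[of y] c(2)[of z] by auto
      then show "\<bar>f y - f z\<bar> < e" by linarith
    qed (use c in auto)
  qed
  obtain d1 d2 where
    d1: "d1 > 0" "\<forall>y\<in>{x-d1<..<x} \<inter> {0..1}. \<forall>z\<in>{x-d1<..<x} \<inter> {0..1}. \<bar>f y - f z\<bar> < e" and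
    d2: "d2 > 0" "\<forall>y\<in>{x<..<x+d2} \<inter> {0..1}. \<forall>z\<in>{x<..<x+d2} \<inter> {0..1}. \<bar>f y - f z\<bar> < e"
    using left right by blast
  show ?thesis
  proof (intro exI[of _ "min d1 d2"] conjI ballI)
    fix y z assume "y \<in> {x - min d1 d2<..<x} \<inter> {0..1}" "z \<in> {x - min d1 d2<..<x} \<inter> {0..1}"
    then show "\<bar>f y - f z\<bar> < e" by (intro d1(2)[rule_format]) auto
  next
    fix y z assume "y \<in> {x<..<x + min d1 d2} \<inter> {0..1}" "z \<in> {x<..<x + min d1 d2} \<inter> {0..1}"
    then show "\<bar>f y - f z\<bar> < e" by (intro d2(2)[rule_format]) auto
  qed (use d1 d2 in auto)
qed

lemma cadlag01_bounded:
  assumes f: "cadlag01 f"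
  shows "\<exists>W. \<forall>x\<in>{0..1}. \<bar>f x\<bar> \<le> W"
proof -
  define P where "P a b = (\<exists>W. \<forall>y\<in>{a..b} \<inter> {0..1}. \<bar>f y\<bar> \<le> W)" for a b
  have "P 0 1"
  proof (rule Bolzano)
    show "(0::real) \<le> 1" by simp
    fix a b c :: real assume "P a b" "P b c"
    then obtain W1 W2 where "\<forall>y\<in>{a..b} \<inter> {0..1}. \<bar>f y\<bar> \<le> W1" "\<forall>y\<in>{b..c} \<inter> {0..1}. \<bar>f y\<bar> \<le> W2"
      by (auto simp: P_def)
    then show "P a c" unfolding P_def
      by (intro exI[of _ "max W1 W2"]) (auto simp: le_max_iff_disj)
  next
    fix x :: real assume "0 \<le> x" "x \<le> 1"
    then obtain d where d: "d > 0"
      "\<And>y z. y \<in> {x-d<..<x} \<inter> {0..1} \<Longrightarrow> z \<in> {x-d<..<x} \<inter> {0..1} \<Longrightarrow> \<bar>f y - f z\<bar> < 1"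
      "\<And>y z. y \<in> {x<..<x+d} \<inter> {0..1} \<Longrightarrow> z \<in> {x<..<x+d} \<inter> {0..1} \<Longrightarrow> \<bar>f y - f z\<bar> < 1"
      using cadlag01_oscillation[OF f, of x 1] by auto
    have one: "\<exists>W. \<forall>y\<in>S. \<bar>f y\<bar> \<le> W" if S: "\<And>y z. y \<in> S \<Longrightarrow> z \<in> S \<Longrightarrow> \<bar>f y - f z\<bar> < 1" for S
    proof (cases "S = {}")
      case False
      then obtain z where "z \<in> S" by auto
      then have "\<bar>f y\<bar> \<le> \<bar>f z\<bar> + 1" if "y \<in> S" for y using S[OF that \<open>z \<in> S\<close>] by linarith
      then show ?thesis by blast
    qed auto
    from one[OF d(2)] obtain W1 where W1: "\<forall>y\<in>{x-d<..<x} \<inter> {0..1}. \<bar>f y\<bar> \<le> W1" ..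
    from one[OF d(3)] obtain W2 where W2: "\<forall>y\<in>{x<..<x+d} \<inter> {0..1}. \<bar>f y\<bar> \<le> W2" ..
    have "P a b" if ab: "a \<le> x" "x \<le> b" "b - a < d" for a b
      unfolding P_def
    proof (intro exI[of _ "max (max W1 W2) \<bar>f x\<bar>"] ballI)
      fix y assume y: "y \<in> {a..b} \<inter> {0..1}"
      consider "y < x" | "y = x" | "y > x" by linarith
      then show "\<bar>f y\<bar> \<le> max (max W1 W2) \<bar>f x\<bar>"
      proof cases
        case 1
        then have "y \<in> {x-d<..<x} \<inter> {0..1}" using y ab by auto
        then have "\<bar>f y\<bar> \<le> W1" using W1 by blast
        then show ?thesis by (simp add: le_max_iff_disj)
      next
        case 3
        then have "y \<in> {x<..<x+d} \<inter> {0..1}" using y ab by auto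
        then have "\<bar>f y\<bar> \<le> W2" using W2 by blast
        then show ?thesis by (simp add: le_max_iff_disj)
      qed simp
    qed
    then show "\<exists>d>0. \<forall>a b. a \<le> x \<and> x \<le> b \<and> b - a < d \<longrightarrow> P a b"
      using d(1) by blast
  qed
  then show ?thesis by (simp add: P_def)
qed

text \<open>Points with oscillation at least \<open>e\<close> cannot accumulate in the compact interval, hence there
  are finitely many of them for each \<open>e\<close>.\<close>

lemma cadlag01_countable_discontinuities:
  assumes f: "cadlag01 f"
  shows "\<exists>D. countable D \<and> (\<forall>x\<in>{0<..<1} - D. isCont f x)"
proof -
  define J where "J e = {x\<in>{0..1}. \<not> (\<exists>d>0. \<forall>y\<in>ball x d \<inter> {0..1}. \<forall>z\<in>ball x d \<inter> {0..1}. \<bar>f y - f z\<bar> < e)}"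
    for e :: real
  have "finite ({0..1} \<inter> J e)" if e: "0 < e" for e
  proof (rule finite_not_islimpt_in_compact)
    fix x :: real assume x: "x \<in> {0..1}"
    obtain d where d: "d > 0"
      "\<And>y z. y \<in> {x-d<..<x} \<inter> {0..1} \<Longrightarrow> z \<in> {x-d<..<x} \<inter> {0..1} \<Longrightarrow> \<bar>f y - f z\<bar> < e"
      "\<And>y z. y \<in> {x<..<x+d} \<inter> {0..1} \<Longrightarrow> z \<in> {x<..<x+d} \<inter> {0..1} \<Longrightarrow> \<bar>f y - f z\<bar> < e"
      using cadlag01_oscillation[OF f x e] by auto
    show "\<not> x islimpt J e"
    proof
      assume "x islimpt J e"
      then obtain t where t: "t \<in> J e" "t \<noteq> x" "dist t x < d"
        using d(1) unfolding islimpt_approachable by blast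
      define r where "r = (if t < x then min (x - t) (t - (x - d)) else min (t - x) (x + d - t))"
      have r: "r > 0" using t by (auto simp: r_def dist_real_def)
      have "\<bar>f y - f z\<bar> < e" if "y \<in> ball t r \<inter> {0..1}" "z \<in> ball t r \<inter> {0..1}" for y z
      proof (cases "t < x")
        case True
        then have "y \<in> {x-d<..<x} \<inter> {0..1}" "z \<in> {x-d<..<x} \<inter> {0..1}"
          using that by (auto simp: r_def dist_real_def)
        then show ?thesis by (rule d(2))
      next
        case False
        then have "y \<in> {x<..<x+d} \<inter> {0..1}" "z \<in> {x<..<x+d} \<inter> {0..1}"
          using that t(2) by (auto simp: r_def dist_real_def)
        then show ?thesis by (rule d(3))
      qed
      with r t(1) show False by (auto simp: J_def)
    qed
  qed simp
  moreover have "{0..1} \<inter> J e = J e" for e by (auto simp: J_def)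
  ultimately have "countable (\<Union>n. J (1 / real (Suc n)))"
    by (intro countable_UN[OF countableI_type] countable_finite) simp
  moreover have "isCont f x" if x: "x \<in> {0<..<1} - (\<Union>n. J (1 / real (Suc n)))" for x
  proof (unfold continuous_at_eps_delta, intro allI impI)
    fix e :: real assume "0 < e"
    then obtain n where n: "1 / real (Suc n) < e" using nat_approx_posE by blast
    from x have "\<exists>d>0. \<forall>y\<in>ball x d \<inter> {0..1}. \<forall>z\<in>ball x d \<inter> {0..1}. \<bar>f y - f z\<bar> < 1 / real (Suc n)"
      by (auto simp: J_def)
    then obtain d where d: "d > 0"
      "\<forall>y\<in>ball x d \<inter> {0..1}. \<forall>z\<in>ball x d \<inter> {0..1}. \<bar>f y - f z\<bar> < 1 / real (Suc n)"
      by blast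
    show "\<exists>d>0. \<forall>y. dist y x < d \<longrightarrow> dist (f y) (f x) < e"
    proof (intro exI[of _ "min d (min x (1 - x))"] conjI allI impI)
      show "0 < min d (min x (1 - x))" using d(1) x by auto
      fix y assume "dist y x < min d (min x (1 - x))"
      then have "y \<in> ball x d \<inter> {0..1}" "x \<in> ball x d \<inter> {0..1}"
        using x d(1) by (auto simp: dist_real_def)
      from d(2)[rule_format, OF this] n show "dist (f y) (f x) < e" by (simp add: dist_real_def)
    qed
  qed
  ultimately show ?thesis by blast
qed

lemma step_function_integral:
  fixes g :: "nat \<Rightarrow> real"
  assumes b: "0 < b"
  shows "(LINT x:{0..1}|lborel. g (nat \<lceil>x * real b\<rceil>)) = (\<Sum>j\<in>{1..b}. g j) / real b"
proof -
  define I where "I j = {(real j - 1) / real b <.. real j / real b}" for j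
  have eq: "indicator {0..1} x *\<^sub>R g (nat \<lceil>x * real b\<rceil>) = (\<Sum>j\<in>{1..b}. indicator (I j) x * g j)"
    if x0: "x \<noteq> 0" for x
  proof -
    have I_iff: "x \<in> I j \<longleftrightarrow> nat \<lceil>x * real b\<rceil> = j" if "1 \<le> j" for j
    proof -
      have "x \<in> I j \<longleftrightarrow> real_of_int (int j) - 1 < x * real b \<and> x * real b \<le> real_of_int (int j)"
        using b by (simp add: I_def field_simps)
      also have "\<dots> \<longleftrightarrow> \<lceil>x * real b\<rceil> = int j"
        by (auto simp: ceiling_eq_iff)
      also have "\<dots> \<longleftrightarrow> nat \<lceil>x * real b\<rceil> = j" using that by auto
      finally show ?thesis .
    qed
    have "x \<in> {0..1} \<longleftrightarrow> nat \<lceil>x * real b\<rceil> \<in> {1..b}"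
    proof -
      have "x \<in> {0..1} \<longleftrightarrow> 0 < x * real b \<and> x * real b \<le> real b"
        using b x0 by (auto simp: zero_less_mult_iff)
      also have "\<dots> \<longleftrightarrow> 0 < \<lceil>x * real b\<rceil> \<and> \<lceil>x * real b\<rceil> \<le> int b"
        by (simp add: ceiling_le_iff)
      also have "\<dots> \<longleftrightarrow> nat \<lceil>x * real b\<rceil> \<in> {1..b}"
      proof -
        have "0 < k \<and> k \<le> int b \<longleftrightarrow> nat k \<in> {1..b}" for k by auto
        then show ?thesis .
      qed
      finally show ?thesis .
    qed
    moreover have "(\<Sum>j\<in>{1..b}. indicator (I j) x * g j)
        = (\<Sum>j\<in>{1..b}. if nat \<lceil>x * real b\<rceil> = j then g j else 0)"
      by (intro sum.cong refl) (auto simp: I_iff indicator_def)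
    ultimately show ?thesis by (auto simp: indicator_def)
  qed
  have Ii: "integrable lborel (indicator (I j) :: real \<Rightarrow> real)" "measure lborel (I j) = 1 / real b" for j
    using b by (auto simp: I_def field_simps)
  have "(LINT x:{0..1}|lborel. g (nat \<lceil>x * real b\<rceil>)) = (LINT x|lborel. (\<Sum>j\<in>{1..b}. indicator (I j) x * g j))"
    unfolding set_lebesgue_integral_def
  proof (rule integral_cong_AE)
    show "AE x in lborel. indicator {0..1} x *\<^sub>R g (nat \<lceil>x * real b\<rceil>) = (\<Sum>j\<in>{1..b}. indicator (I j) x * g j)"
      using AE_lborel_singleton[of "0::real"] by eventually_elim (rule eq)
    show "(\<lambda>x. \<Sum>j\<in>{1..b}. indicator (I j) x * g j) \<in> borel_measurable lborel"
      unfolding I_def by measurable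
  qed measurable
  also have "\<dots> = (\<Sum>j\<in>{1..b}. (LINT x|lborel. indicator (I j) x * g j))"
    using Ii by (intro Bochner_Integration.integral_sum) auto
  also have "\<dots> = (\<Sum>j\<in>{1..b}. g j / real b)"
    using Ii by (intro sum.cong refl) (simp add: I_def)
  finally show ?thesis by (simp add: sum_divide_distrib)
qed

lemma mean_abs_difference_convergence:
  fixes \<phi> :: "nat \<Rightarrow> 'a \<Rightarrow> real"
  assumes N: "prob_space N"
    and meas: "\<And>n. \<phi> n \<in> borel_measurable N" "\<psi> \<in> borel_measurable N"
    and bound: "\<And>n x. x \<in> space N \<Longrightarrow> \<bar>\<phi> n x\<bar> \<le> C"
    and lim: "AE x in N. (\<lambda>n. \<phi> n x) \<longlonglongrightarrow> \<psi> x"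
  shows "(\<lambda>n. \<integral>x. (\<integral>y. \<bar>\<phi> n x - \<phi> n y\<bar> \<partial>N) \<partial>N) \<longlonglongrightarrow> (\<integral>x. (\<integral>y. \<bar>\<psi> x - \<psi> y\<bar> \<partial>N) \<partial>N)"
proof -
  interpret prob_space N by fact
  note [measurable] = meas
  have b2: "\<bar>\<phi> n x - \<phi> n y\<bar> \<le> 2 * C" if "x \<in> space N" "y \<in> space N" for n x y
    using bound[OF that(1), of n] bound[OF that(2), of n] by linarith
  have inner: "(\<lambda>n. \<integral>y. \<bar>\<phi> n x - \<phi> n y\<bar> \<partial>N) \<longlonglongrightarrow> (\<integral>y. \<bar>\<psi> x - \<psi> y\<bar> \<partial>N)"
    if x: "x \<in> space N" "(\<lambda>n. \<phi> n x) \<longlonglongrightarrow> \<psi> x" for x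
  proof (rule integral_dominated_convergence[where w = "\<lambda>_. 2 * C"])
    show "AE y in N. (\<lambda>n. \<bar>\<phi> n x - \<phi> n y\<bar>) \<longlonglongrightarrow> \<bar>\<psi> x - \<psi> y\<bar>"
      using lim by eventually_elim (intro tendsto_intros x)
    show "AE y in N. norm \<bar>\<phi> n x - \<phi> n y\<bar> \<le> 2 * C" for n
      using b2[OF x(1)] by (intro AE_I2) simp
  qed auto
  show ?thesis
  proof (rule integral_dominated_convergence[where w = "\<lambda>_. 2 * C"])
    show "AE x in N. (\<lambda>n. \<integral>y. \<bar>\<phi> n x - \<phi> n y\<bar> \<partial>N) \<longlonglongrightarrow> (\<integral>y. \<bar>\<psi> x - \<psi> y\<bar> \<partial>N)"
      using lim AE_space by eventually_elim (rule inner)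
    show "AE x in N. norm (\<integral>y. \<bar>\<phi> n x - \<phi> n y\<bar> \<partial>N) \<le> 2 * C" for n
    proof (rule AE_I2)
      fix x assume x: "x \<in> space N"
      have "0 \<le> (\<integral>y. \<bar>\<phi> n x - \<phi> n y\<bar> \<partial>N)" by (rule integral_nonneg_AE) simp
      moreover have "(\<integral>y. \<bar>\<phi> n x - \<phi> n y\<bar> \<partial>N) \<le> 2 * C"
      proof (rule integral_le_const)
        show "integrable N (\<lambda>y. \<bar>\<phi> n x - \<phi> n y\<bar>)"
          by (rule integrable_const_bound[of _ "2 * C"]) (use b2[OF x] in auto)
      qed (use b2[OF x] in auto)
      ultimately show "norm (\<integral>y. \<bar>\<phi> n x - \<phi> n y\<bar> \<partial>N) \<le> 2 * C" by simp
    qed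
  qed auto
qed

lemma sum_average_bounds:
  fixes g :: "nat \<Rightarrow> real"
  assumes B: "finite B" "B \<noteq> {}" and g: "\<And>i. i \<in> B \<Longrightarrow> c \<le> g i \<and> g i \<le> C"
  shows "c \<le> (1 / real (card B)) * (\<Sum>i\<in>B. g i)" "(1 / real (card B)) * (\<Sum>i\<in>B. g i) \<le> C"
proof -
  have pos: "0 < real (card B)" using B by (simp add: card_gt_0_iff)
  have "real (card B) * c \<le> (\<Sum>i\<in>B. g i)" "(\<Sum>i\<in>B. g i) \<le> real (card B) * C"
    using g by (auto intro!: sum_bounded_below sum_bounded_above)
  then show "c \<le> (1 / real (card B)) * (\<Sum>i\<in>B. g i)" "(1 / real (card B)) * (\<Sum>i\<in>B. g i) \<le> C"
    using pos by (simp_all add: field_simps)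
qed

lemma block_point_unit_interval:
  fixes l b j i n :: nat
  assumes n: "n = l * b" "1 \<le> l" "1 \<le> b" and j: "1 \<le> j" "j \<le> b" and i: "i \<in> {(j - 1) * l + 1..j * l}"
  shows "real i / real n \<in> {0..1}" "real i / real n \<in> {(real j - 1) / real b..real j / real b}"
proof -
  note ib = block_index_bounds[OF j i]
  have pos: "0 < real l" "0 < real b" using n by auto
  have nr: "real n = real l * real b" by (simp add: n)
  show "real i / real n \<in> {0..1}"
    using ib(2) pos n by (simp add: nr divide_le_eq flip: of_nat_mult)
  have "real i / real n \<le> real j * real l / real n"
    using ib(3) by (intro divide_right_mono) auto
  moreover have "(real j - 1) * real l / real n \<le> real i / real n"
    using ib(4) by (intro divide_right_mono) auto
  ultimately show "real i / real n \<in> {(real j - 1) / real b..real j / real b}"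
    using pos by (simp add: nr)
qed

definition block_scale :: "(real \<Rightarrow> real) \<Rightarrow> nat \<Rightarrow> nat \<Rightarrow> nat \<Rightarrow> real" where
  "block_scale \<sigma> l n j = (1 / real l) * (\<Sum>i\<in>{(j - 1) * l + 1..j * l}. (\<sigma> (real i / real n))\<^sup>2)"

lemma block_scale_bounds:
  assumes n: "n = l * b" "1 \<le> l" "1 \<le> b" and j: "1 \<le> j" "j \<le> b"
    and \<sigma>: "0 < c" "\<And>x. x \<in> {0..1} \<Longrightarrow> c \<le> \<sigma> x" "\<And>x. x \<in> {0..1} \<Longrightarrow> \<sigma> x \<le> W"
  shows "c\<^sup>2 \<le> block_scale \<sigma> l n j" "block_scale \<sigma> l n j \<le> W\<^sup>2"
proof -
  define B where "B = {(j - 1) * l + 1..j * l}"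
  have card: "card B = l" unfolding B_def by (rule block_card[OF j(1)])
  then have B: "finite B" "B \<noteq> {}" using n by (auto simp: B_def)
  have g: "c\<^sup>2 \<le> (\<sigma> (real i / real n))\<^sup>2 \<and> (\<sigma> (real i / real n))\<^sup>2 \<le> W\<^sup>2" if "i \<in> B" for i
    using \<sigma>(1) \<sigma>(2,3)[OF block_point_unit_interval(1)[OF n j that[unfolded B_def]]]
    by (intro conjI power_mono) auto
  show "c\<^sup>2 \<le> block_scale \<sigma> l n j" "block_scale \<sigma> l n j \<le> W\<^sup>2"
    using sum_average_bounds[OF B g, unfolded card] by (simp_all add: block_scale_def B_def)
qed

lemma block_scale_mean_difference_limit:
  fixes \<sigma> :: "real \<Rightarrow> real" and l b :: "nat \<Rightarrow> nat"
  assumes cad: "cadlag01 \<sigma>" and \<sigma>0: "0 < \<sigma>\<^sub>0" "\<And>x. x \<in> {0..1} \<Longrightarrow> \<sigma>\<^sub>0 \<le> \<sigma> x"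
    and blocks: "\<And>n. n \<in> A \<Longrightarrow> 1 \<le> n \<Longrightarrow> n = l n * b n"
    and b_lim: "filterlim (\<lambda>n. real (b n)) at_top (at_top \<sqinter> principal A)"
  shows "((\<lambda>n. (1 / (real (b n) * (real (b n) - 1))) * (\<Sum>j\<in>{1..b n}. \<Sum>k\<in>{1..b n} - {j}.
        \<bar>ln (block_scale \<sigma> (l n) n j) - ln (block_scale \<sigma> (l n) n k)\<bar>))
      \<longlongrightarrow> (LBINT x:{0..1}. LBINT y:{0..1}. \<bar>ln ((\<sigma> x)^2) - ln ((\<sigma> y)^2)\<bar>)) (at_top \<sqinter> principal A)"
proof -
  obtain W0 where W0: "\<forall>x\<in>{0..1}. \<bar>\<sigma> x\<bar> \<le> W0" using cadlag01_bounded[OF cad] by blast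
  define W where "W = max W0 1"
  have W: "\<sigma> x \<le> W" if "x \<in> {0..1}" for x using W0 that by (force simp: W_def)
  obtain D where D: "countable D" "\<And>x. x \<in> {0<..<1} - D \<Longrightarrow> isCont \<sigma> x"
    using cadlag01_countable_discontinuities[OF cad] by blast
  define N where "N = restrict_space lborel {0..1::real}"
  have spN: "space N = {0..1}" by (simp add: N_def space_restrict_space)
  have prob: "prob_space N"
    by (intro prob_spaceI) (simp add: N_def space_restrict_space emeasure_restrict_space)
  have intN: "(\<integral>x. F x \<partial>N) = (LBINT x:{0..1}. F x)" for F :: "real \<Rightarrow> real"
    unfolding N_def set_lebesgue_integral_def by (rule integral_restrict_space) simp
  have measN: "F \<in> borel_measurable N" if "F \<in> borel_measurable borel" for F :: "real \<Rightarrow> real"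
    using that unfolding N_def by (intro measurable_restrict_space1) simp
  define \<psi> where "\<psi> x = (if x \<in> {0..1} then ln ((\<sigma> x)\<^sup>2) else 0)" for x
  have psi_cont: "isCont \<psi> x" if x: "x \<notin> D \<union> {0, 1}" for x
  proof (cases "x \<in> {0<..<1}")
    case True
    then have "isCont \<sigma> x" "\<sigma> x \<noteq> 0"
      using x D(2)[of x] \<sigma>0(1) \<sigma>0(2)[of x] by auto
    then have "isCont (\<lambda>x. ln ((\<sigma> x)\<^sup>2)) x" by (intro continuous_intros) auto
    moreover have "\<forall>\<^sub>F y in nhds x. \<psi> y = ln ((\<sigma> y)\<^sup>2)"
      using eventually_nhds_in_open[of "{0<..<1}" x] True
      by (auto simp: \<psi>_def elim!: eventually_mono)
    ultimately show ?thesis by (subst isCont_cong)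
  next
    case False
    then have "x \<in> - {0..1}" using x by auto
    then have "\<forall>\<^sub>F y in nhds x. y \<in> - {0..1}"
      by (intro eventually_nhds_in_open open_Compl closed_atLeastAtMost)
    then have "\<forall>\<^sub>F y in nhds x. \<psi> y = 0"
      by eventually_elim (auto simp: \<psi>_def)
    then show ?thesis by (subst isCont_cong[of _ "\<lambda>_. 0"]) auto
  qed
  have psi_meas: "\<psi> \<in> borel_measurable N"
    using D(1) psi_cont
    by (intro measN borel_measurable_continuous_countable_exceptions[of "D \<union> {0, 1}"])
      (auto intro!: continuous_at_imp_continuous_on)
  define good where "good n \<longleftrightarrow> n \<in> A \<and> 1 \<le> n \<and> 2 \<le> b n" for n
  have good: "n = l n * b n" "1 \<le> l n" "1 \<le> b n" if "good n" for n
  proof -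
    show "n = l n * b n" using that blocks by (auto simp: good_def)
    then show "1 \<le> l n" "1 \<le> b n" using that by (auto simp: good_def intro!: Suc_leI gr0I)
  qed
  have ev_good: "\<forall>\<^sub>F n in at_top \<sqinter> principal A. good n"
  proof -
    have "\<forall>\<^sub>F n in at_top \<sqinter> principal A. 2 \<le> real (b n)"
      using b_lim by (rule filterlim_at_top[THEN iffD1, rule_format])
    moreover have "\<forall>\<^sub>F n in at_top \<sqinter> principal A. 1 \<le> n"
      by (rule filter_leD[OF inf_le1 eventually_ge_at_top])
    moreover have "\<forall>\<^sub>F n in at_top \<sqinter> principal A. n \<in> A"
      by (simp add: eventually_inf_principal)
    ultimately show ?thesis by eventually_elim (auto simp: good_def)
  qed
  define V where "V n = block_scale \<sigma> (l n) n" for n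
  define J where "J n x = nat \<lceil>x * real (b n)\<rceil>" for n and x :: real
  define \<phi> where "\<phi> n x = (if good n then ln (V n (J n x)) else \<psi> x)" for n x
  have Jb: "J n x \<le> b n" if "x \<in> {0..1}" for n x
  proof -
    have "x * real (b n) \<le> 1 * real (b n)" using that by (intro mult_right_mono) auto
    then show ?thesis by (simp add: J_def nat_le_iff ceiling_le_iff)
  qed
  have lnb: "\<bar>ln v\<bar> \<le> \<bar>ln (\<sigma>\<^sub>0\<^sup>2)\<bar> + \<bar>ln (W\<^sup>2)\<bar>" if "\<sigma>\<^sub>0\<^sup>2 \<le> v" "v \<le> W\<^sup>2" for v
  proof -
    have "0 < \<sigma>\<^sub>0\<^sup>2" using \<sigma>0 by simp
    moreover from this have "0 < v" using that by linarith
    ultimately have "ln (\<sigma>\<^sub>0\<^sup>2) \<le> ln v" "ln v \<le> ln (W\<^sup>2)"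
      using that by (simp_all add: ln_mono)
    then show ?thesis by linarith
  qed
  have phi_meas: "\<phi> n \<in> borel_measurable N" for n
  proof (cases "good n")
    case True
    have "J n \<in> borel \<rightarrow>\<^sub>M count_space UNIV"
      unfolding J_def[abs_def] by measurable
    then have "(\<lambda>x. ln (V n (J n x))) \<in> borel_measurable borel"
      by (rule measurable_compose) simp
    from measN[OF this] show ?thesis using True by (simp add: \<phi>_def[abs_def])
  next
    case False
    then show ?thesis using psi_meas by (simp add: \<phi>_def[abs_def])
  qed
  have phi_bound: "\<bar>\<phi> n x\<bar> \<le> \<bar>ln (\<sigma>\<^sub>0\<^sup>2)\<bar> + \<bar>ln (W\<^sup>2)\<bar>" if "x \<in> space N" for n x
  proof (cases "good n")
    case True
    show ?thesis
    proof (cases "J n x = 0")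
      case True
      then show ?thesis by (simp add: \<phi>_def V_def block_scale_def \<open>good n\<close>)
    next
      case False
      then have "\<sigma>\<^sub>0\<^sup>2 \<le> V n (J n x)" "V n (J n x) \<le> W\<^sup>2"
        unfolding V_def using that spN \<sigma>0 W Jb
        by (intro block_scale_bounds[OF good[OF True]]; auto)+
      then show ?thesis using True lnb by (simp add: \<phi>_def)
    qed
  next
    case False
    have x: "x \<in> {0..1}" using that spN by simp
    then have "\<sigma>\<^sub>0\<^sup>2 \<le> (\<sigma> x)\<^sup>2" "(\<sigma> x)\<^sup>2 \<le> W\<^sup>2"
      using \<sigma>0(1) \<sigma>0(2)[OF x] W[OF x] by (intro power_mono; linarith)+
    then show ?thesis using False x lnb by (simp add: \<phi>_def \<psi>_def)
  qed
  have phi_lim: "(\<lambda>n. \<phi> n x) \<longlonglongrightarrow> \<psi> x" if x: "x \<in> {0<..<1} - D" for x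
  proof -
    define v where "v n = (if good n then V n (J n x) else (\<sigma> x)\<^sup>2)" for n
    have x01: "x \<in> {0..1}" using x by auto
    have "v \<longlonglongrightarrow> (\<sigma> x)\<^sup>2"
    proof (rule LIMSEQ_I)
      fix e :: real assume e: "0 < e"
      have "isCont (\<lambda>x. (\<sigma> x)\<^sup>2) x" using D(2)[OF x] by (intro continuous_intros)
      then obtain d where d: "0 < d" "\<And>y. \<bar>y - x\<bar> < d \<Longrightarrow> \<bar>(\<sigma> y)\<^sup>2 - (\<sigma> x)\<^sup>2\<bar> < e / 2"
        using half_gt_zero[OF e] unfolding continuous_at_eps_delta dist_real_def by meson
      have "\<forall>\<^sub>F n in at_top \<sqinter> principal A. 1 / d < real (b n)"
        using b_lim by (simp add: filterlim_at_top_dense)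
      then have "\<forall>\<^sub>F n in sequentially. n \<in> A \<longrightarrow> 1 / d < real (b n)"
        by (simp add: eventually_inf_principal)
      then have "\<forall>\<^sub>F n in sequentially. norm (v n - (\<sigma> x)\<^sup>2) < e"
      proof eventually_elim
        case (elim n)
        show ?case
        proof (cases "good n")
          case True
          let ?j = "J n x" and ?B = "{(J n x - 1) * l n + 1..J n x * l n}"
          have b: "0 < real (b n)" "1 / real (b n) < d"
            using elim True d(1) by (auto simp: good_def field_simps)
          have xb: "0 < x * real (b n)" using x b by simp
          have j: "1 \<le> ?j" "?j \<le> b n" using xb Jb[OF x01, of n] by (auto simp: J_def Suc_le_eq)
          have "real ?j = of_int \<lceil>x * real (b n)\<rceil>" using xb by (simp add: J_def)
          then have xj: "(real ?j - 1) / real (b n) \<le> x" "x \<le> real ?j / real (b n)"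
            using b by (simp_all add: field_simps) linarith+
          have near: "\<bar>(\<sigma> x)\<^sup>2 - (\<sigma> (real i / real n))\<^sup>2\<bar> \<le> e / 2" if i: "i \<in> ?B" for i
          proof -
            have "real i / real n \<in> {(real ?j - 1) / real (b n)..real ?j / real (b n)}"
              by (rule block_point_unit_interval(2)[OF good[OF True] j i])
            with xj b(2) have "\<bar>real i / real n - x\<bar> < d"
              by (auto simp: diff_divide_distrib abs_le_iff)
            from d(2)[OF this] show ?thesis by linarith
          qed
          have "card ?B = l n" by (rule block_card[OF j(1)])
          moreover have "?B \<noteq> {}" using good(2)[OF True] calculation by (metis card.empty not_one_le_zero)
          ultimately have "\<bar>(\<sigma> x)\<^sup>2 - V n ?j\<bar> \<le> e / 2"
            using abs_mean_diff_le[of ?B "(\<sigma> x)\<^sup>2" "\<lambda>i. (\<sigma> (real i / real n))\<^sup>2", OF _ _ near]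
            by (simp add: V_def block_scale_def)
          then have "\<bar>V n ?j - (\<sigma> x)\<^sup>2\<bar> < e" using e by linarith
          then show ?thesis using True by (simp add: v_def)
        qed (simp add: v_def e)
      qed
      then show "\<exists>no. \<forall>n\<ge>no. norm (v n - (\<sigma> x)\<^sup>2) < e"
        by (simp add: eventually_sequentially)
    qed
    then have "(\<lambda>n. ln (v n)) \<longlonglongrightarrow> ln ((\<sigma> x)\<^sup>2)"
      using \<sigma>0(1) \<sigma>0(2)[OF x01] by (intro tendsto_ln) auto
    moreover have "ln (v n) = \<phi> n x" for n using x01 by (simp add: v_def \<phi>_def \<psi>_def)
    ultimately show ?thesis using x01 by (simp add: \<psi>_def)
  qed
  have "AE x in lborel. x \<notin> D \<union> {0, 1::real}"
    using D(1) by (intro AE_not_in countable_imp_null_set_lborel) auto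
  then have "AE x in lborel. x \<in> {0..1} \<longrightarrow> (\<lambda>n. \<phi> n x) \<longlonglongrightarrow> \<psi> x"
    by eventually_elim (auto intro!: phi_lim)
  then have "AE x in N. (\<lambda>n. \<phi> n x) \<longlonglongrightarrow> \<psi> x"
    unfolding N_def by (subst AE_restrict_space_iff) auto
  from mean_abs_difference_convergence[OF prob phi_meas psi_meas phi_bound this]
  have "(\<lambda>n. \<integral>x. (\<integral>y. \<bar>\<phi> n x - \<phi> n y\<bar> \<partial>N) \<partial>N) \<longlonglongrightarrow> (\<integral>x. (\<integral>y. \<bar>\<psi> x - \<psi> y\<bar> \<partial>N) \<partial>N)" .
  moreover have "(\<integral>x. (\<integral>y. \<bar>\<psi> x - \<psi> y\<bar> \<partial>N) \<partial>N)
      = (LBINT x:{0..1}. LBINT y:{0..1}. \<bar>ln ((\<sigma> x)^2) - ln ((\<sigma> y)^2)\<bar>)"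
    unfolding intN by (intro set_lebesgue_integral_cong) (auto simp: \<psi>_def intro!: set_lebesgue_integral_cong)
  ultimately have lim: "((\<lambda>n. \<integral>x. (\<integral>y. \<bar>\<phi> n x - \<phi> n y\<bar> \<partial>N) \<partial>N) \<longlongrightarrow>
      (LBINT x:{0..1}. LBINT y:{0..1}. \<bar>ln ((\<sigma> x)^2) - ln ((\<sigma> y)^2)\<bar>)) (at_top \<sqinter> principal A)"
    by (simp add: tendsto_mono[OF inf_le1])
  have ratio: "((\<lambda>n. real (b n) / (real (b n) - 1)) \<longlongrightarrow> 1) (at_top \<sqinter> principal A)"
  proof -
    have "((\<lambda>t::real. t / (t - 1)) \<longlongrightarrow> 1) at_top" by real_asymp
    from filterlim_compose[OF this b_lim] show ?thesis .
  qed
  have "\<forall>\<^sub>F n in at_top \<sqinter> principal A.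
      real (b n) / (real (b n) - 1) * (\<integral>x. (\<integral>y. \<bar>\<phi> n x - \<phi> n y\<bar> \<partial>N) \<partial>N)
      = (1 / (real (b n) * (real (b n) - 1))) * (\<Sum>j\<in>{1..b n}. \<Sum>k\<in>{1..b n} - {j}. \<bar>ln (V n j) - ln (V n k)\<bar>)"
    using ev_good
  proof eventually_elim
    case (elim n)
    have b: "0 < b n" using good(3)[OF elim] by simp
    let ?a = "\<lambda>j k. \<bar>ln (V n j) - ln (V n k)\<bar>"
    have "(\<integral>x. (\<integral>y. \<bar>\<phi> n x - \<phi> n y\<bar> \<partial>N) \<partial>N)
        = (LBINT x:{0..1}. (LBINT y:{0..1}. ?a (nat \<lceil>x * real (b n)\<rceil>) (nat \<lceil>y * real (b n)\<rceil>)))"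
      using elim unfolding intN by (simp add: \<phi>_def J_def)
    also have "\<dots> = (LBINT x:{0..1}. (\<Sum>k\<in>{1..b n}. ?a (nat \<lceil>x * real (b n)\<rceil>) k) / real (b n))"
      by (simp only: step_function_integral[OF b, of "?a _"])
    also have "\<dots> = (\<Sum>j\<in>{1..b n}. (\<Sum>k\<in>{1..b n}. ?a j k) / real (b n)) / real (b n)"
      by (rule step_function_integral[OF b, of "\<lambda>j. (\<Sum>k\<in>{1..b n}. ?a j k) / real (b n)"])
    also have "\<dots> = (\<Sum>j\<in>{1..b n}. \<Sum>k\<in>{1..b n}. ?a j k) / (real (b n) * real (b n))"
      by (simp flip: sum_divide_distrib)
    also have "(\<Sum>j\<in>{1..b n}. \<Sum>k\<in>{1..b n}. ?a j k) = (\<Sum>j\<in>{1..b n}. \<Sum>k\<in>{1..b n} - {j}. ?a j k)"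
      by (intro sum.cong refl sum.mono_neutral_right) auto
    finally show ?case using b by simp
  qed
  from Lim_transform_eventually[OF _ this] tendsto_mult[OF ratio lim] show ?thesis
    by (simp add: V_def)
qed

subsection \<open>Consistency of the test statistic\<close>

lemma admissible_limits:
  assumes s: "1 / 2 < s" "s < 1"
  shows "filterlim (\<lambda>n. real (bnum s n)) at_top (at_top \<sqinter> principal (admissible_n s))"
    and "((\<lambda>n. real (bnum s n) / real (blen s n)) \<longlongrightarrow> 0) (at_top \<sqinter> principal (admissible_n s))"
proof -
  let ?F = "at_top \<sqinter> principal (admissible_n s)"
  have "\<forall>\<^sub>F n in ?F. 1 \<le> n" by (rule filter_leD[OF inf_le1 eventually_ge_at_top])
  moreover have "\<forall>\<^sub>F n in ?F. n \<in> admissible_n s" by (simp add: eventually_inf_principal)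
  ultimately have ev: "\<forall>\<^sub>F n in ?F. real (bnum s n) = real n powr (1 - s) \<and>
      real (bnum s n) / real (blen s n) = real n powr (1 - 2 * s)"
  proof eventually_elim
    case (elim n)
    then show ?case
      using admissible_blocks[OF elim(2,1)] by (simp flip: powr_diff)
  qed
  have "filterlim (\<lambda>n::nat. real n powr (1 - s)) at_top at_top"
    using s by real_asymp
  then have "filterlim (\<lambda>n::nat. real n powr (1 - s)) at_top ?F"
    by (rule filterlim_mono) auto
  then show "filterlim (\<lambda>n. real (bnum s n)) at_top ?F"
    by (rule filterlim_cong[THEN iffD1, OF refl refl _, rotated]) (use ev in \<open>auto elim: eventually_mono\<close>)
  have "((\<lambda>n::nat. real n powr (1 - 2 * s)) \<longlongrightarrow> 0) at_top"
    using s by real_asymp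
  then have "((\<lambda>n::nat. real n powr (1 - 2 * s)) \<longlongrightarrow> 0) ?F"
    by (rule tendsto_mono[OF inf_le1])
  then show "((\<lambda>n. real (bnum s n) / real (blen s n)) \<longlongrightarrow> 0) ?F"
    by (rule Lim_transform_eventually) (use ev in \<open>auto elim: eventually_mono\<close>)
qed

lemma lipschitz_block_mean_deviation:
  fixes \<mu> :: "real \<Rightarrow> real"
  assumes n: "n = l * b" "1 \<le> l" "1 \<le> b" and j: "1 \<le> j" "j \<le> b" and i: "i \<in> {(j - 1) * l + 1..j * l}"
    and lip: "L-lipschitz_on {0..1} \<mu>"
  shows "\<bar>\<mu> (real i / real n) - (1 / real l) * (\<Sum>r\<in>{(j - 1) * l + 1..j * l}. \<mu> (real r / real n))\<bar> \<le> L / real b"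
proof -
  define B where "B = {(j - 1) * l + 1..j * l}"
  have card: "card B = l" unfolding B_def by (rule block_card[OF j(1)])
  then have B: "finite B" "B \<noteq> {}" using n by (auto simp: B_def)
  have "\<bar>\<mu> (real i / real n) - \<mu> (real r / real n)\<bar> \<le> L / real b" if "r \<in> B" for r
  proof -
    note p = block_point_unit_interval[OF n j i] block_point_unit_interval[OF n j that[unfolded B_def]]
    have "\<bar>\<mu> (real i / real n) - \<mu> (real r / real n)\<bar> \<le> L * \<bar>real i / real n - real r / real n\<bar>"
      using lipschitz_onD[OF lip p(1) p(3)] by (simp add: dist_real_def)
    also have "\<dots> \<le> L * (1 / real b)"
      using p(2,4) lipschitz_on_nonneg[OF lip]
      by (intro mult_left_mono) (auto simp: diff_divide_distrib abs_le_iff)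
    finally show ?thesis by simp
  qed
  from abs_mean_diff_le[OF B this, unfolded card] show ?thesis by (simp add: B_def)
qed

lemma block_var_approximation:
  fixes \<sigma> \<mu> :: "real \<Rightarrow> real" and Y :: "nat \<Rightarrow> 'a \<Rightarrow> real"
    and n l b j :: nat
  defines "B \<equiv> {(j - 1) * l + 1..j * l}"
  defines "\<nu> \<equiv> (1 / real l) * (\<Sum>r\<in>B. \<mu> (real r / real n))"
  assumes l: "l = blen s n"
    and n: "n = l * b" "1 \<le> l" "1 \<le> b" and j: "1 \<le> j" "j \<le> b"
    and lip: "L-lipschitz_on {0..1} \<mu>"
    and d: "0 < d" "d \<le> 1" "(L / real b)\<^sup>2 \<le> d"
    and S: "\<bar>\<Sum>i\<in>B. (\<sigma> (real i / real n))\<^sup>2 * ((Y i \<omega>)\<^sup>2 - 1)\<bar> < d * real l"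
      "\<bar>\<Sum>i\<in>B. \<sigma> (real i / real n) * Y i \<omega>\<bar> < d * real l"
      "\<bar>\<Sum>i\<in>B. (\<mu> (real i / real n) - \<nu>) * \<sigma> (real i / real n) * Y i \<omega>\<bar> < d * real l"
  shows "\<bar>block_var \<sigma> \<mu> Y s n j \<omega> - block_scale \<sigma> l n j\<bar> \<le> 5 * d"
proof -
  have l0: "0 < real l" using n by simp
  have card: "card (B) = l" unfolding B_def by (rule block_card[OF j(1)])
  then have B: "finite (B)" "B \<noteq> {}" using n by (auto simp: B_def)
  let ?x = "\<lambda>i. \<sigma> (real i / real n) * Y i \<omega>" and ?u = "\<lambda>i. \<mu> (real i / real n)"
  have small: "\<bar>(1 / real l) * t\<bar> \<le> d" if "\<bar>t\<bar> < d * real l" for t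
    using that l0 by (simp add: abs_mult field_simps)
  have "block_var \<sigma> \<mu> Y s n j \<omega>
      = (1 / real l) * (\<Sum>i\<in>B. (?x i + ?u i - (1 / real l) * (\<Sum>r\<in>B. ?x r + ?u r))\<^sup>2)"
    by (simp add: block_var_def Let_def obs_def B_def l)
  also have "\<dots> = (1 / real l) * (\<Sum>i\<in>B. (?x i)\<^sup>2) - ((1 / real l) * (\<Sum>i\<in>B. ?x i))\<^sup>2
      + 2 * ((1 / real l) * (\<Sum>i\<in>B. (?u i - \<nu>) * ?x i)) + (1 / real l) * (\<Sum>i\<in>B. (?u i - \<nu>)\<^sup>2)"
    unfolding \<nu>_def by (rule variance_of_sum_expansion[OF B(1) _ l0]) (simp add: card)
  also have "(1 / real l) * (\<Sum>i\<in>B. (?x i)\<^sup>2)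
      = block_scale \<sigma> l n j + (1 / real l) * (\<Sum>i\<in>B. (\<sigma> (real i / real n))\<^sup>2 * ((Y i \<omega>)\<^sup>2 - 1))"
    by (simp add: block_scale_def B_def power_mult_distrib sum_subtractf algebra_simps)
  finally have eq: "block_var \<sigma> \<mu> Y s n j \<omega> - block_scale \<sigma> l n j
      = (1 / real l) * (\<Sum>i\<in>B. (\<sigma> (real i / real n))\<^sup>2 * ((Y i \<omega>)\<^sup>2 - 1)) - ((1 / real l) * (\<Sum>i\<in>B. ?x i))\<^sup>2
      + 2 * ((1 / real l) * (\<Sum>i\<in>B. (?u i - \<nu>) * ?x i)) + (1 / real l) * (\<Sum>i\<in>B. (?u i - \<nu>)\<^sup>2)"
    by simp
  have 1: "\<bar>(1 / real l) * (\<Sum>i\<in>B. (\<sigma> (real i / real n))\<^sup>2 * ((Y i \<omega>)\<^sup>2 - 1))\<bar> \<le> d"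
    by (rule small[OF S(1)])
  have "\<bar>(1 / real l) * (\<Sum>i\<in>B. ?x i)\<bar> \<le> d" by (rule small[OF S(2)])
  then have "\<bar>(1 / real l) * (\<Sum>i\<in>B. ?x i)\<bar>\<^sup>2 \<le> d\<^sup>2" by (rule power_mono) simp
  also have "d\<^sup>2 \<le> d" using d by (simp add: power2_eq_square mult_left_le_one_le)
  finally have 2: "((1 / real l) * (\<Sum>i\<in>B. ?x i))\<^sup>2 \<le> d" unfolding power2_abs .
  have 3: "\<bar>(1 / real l) * (\<Sum>i\<in>B. (?u i - \<nu>) * ?x i)\<bar> \<le> d"
    by (rule small) (use S(3) in \<open>simp add: mult.assoc\<close>)
  have "0 \<le> (?u i - \<nu>)\<^sup>2 \<and> (?u i - \<nu>)\<^sup>2 \<le> d" if "i \<in> B" for i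
  proof -
    have "\<bar>?u i - \<nu>\<bar> \<le> L / real b"
      using lipschitz_block_mean_deviation[OF n j that[unfolded B_def] lip] by (simp add: \<nu>_def B_def)
    then have "\<bar>?u i - \<nu>\<bar>\<^sup>2 \<le> (L / real b)\<^sup>2" by (rule power_mono) simp
    with d(3) show ?thesis by simp
  qed
  from sum_average_bounds[OF B this, unfolded card]
  have 4: "0 \<le> (1 / real l) * (\<Sum>i\<in>B. (?u i - \<nu>)\<^sup>2)" "(1 / real l) * (\<Sum>i\<in>B. (?u i - \<nu>)\<^sup>2) \<le> d"
    by auto
  have "0 \<le> ((1 / real l) * (\<Sum>i\<in>B. ?x i))\<^sup>2" by simp
  with 1 2 3 4 show ?thesis unfolding eq by linarith
qed

theorem theorem2p3:
  fixes M :: "'a measure" and Y :: "nat \<Rightarrow> 'a \<Rightarrow> real"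
    and \<mu> \<sigma> :: "real \<Rightarrow> real" and \<sigma>\<^sub>0 \<theta> s :: real
  assumes M: "prob_space M"
    and Y_meas: "\<And>i. Y i \<in> borel_measurable M"
    and stat: "strictly_stationary M Y"
    and mean0: "integral\<^sup>L M (Y 1) = 0"
    and var1: "integral\<^sup>L M (\<lambda>\<omega>. (Y 1 \<omega> - integral\<^sup>L M (Y 1))^2) = 1"
    and abs_reg: "beta_proc M Y \<longlonglongrightarrow> 0"
    and lrv_fin: "summable (\<lambda>k. covariance M (\<lambda>\<omega>. (Y 1 \<omega>)^2) (\<lambda>\<omega>. (Y (Suc k + 1) \<omega>)^2))"
    and lrv_pos: "covariance M (\<lambda>\<omega>. (Y 1 \<omega>)^2) (\<lambda>\<omega>. (Y 1 \<omega>)^2)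
        + 2 * (\<Sum>k. covariance M (\<lambda>\<omega>. (Y 1 \<omega>)^2) (\<lambda>\<omega>. (Y (Suc k + 1) \<omega>)^2)) > 0"
    and theta: "\<theta> > 0"
    and A1: "integrable M (\<lambda>\<omega>. \<bar>Y 1 \<omega>\<bar> powr (4 + 2 * \<theta>))"
    and A2: "summable (\<lambda>k. beta_proc M Y (Suc k) powr (\<theta> / (2 + \<theta>)))"
    and s: "0.5 < s" "s < 0.75"
    and mu_lip: "\<exists>L. L-lipschitz_on {0..1} \<mu>"
    and sigma_cadlag: "cadlag01 \<sigma>"
    and sigma0: "\<sigma>\<^sub>0 > 0" "\<And>x. x \<in> {0..1} \<Longrightarrow> \<sigma> x \<ge> \<sigma>\<^sub>0"
  shows "tendsto_in_prob M (U_stat \<sigma> \<mu> Y s)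
           (LBINT x:{0..1}. LBINT y:{0..1}. \<bar>ln ((\<sigma> x)^2) - ln ((\<sigma> y)^2)\<bar>)
           (at_top \<sqinter> principal (admissible_n s))"
proof -
  interpret prob_space M by fact
  let ?F = "at_top \<sqinter> principal (admissible_n s)"
  define c where "c = (LBINT x:{0..1}. LBINT y:{0..1}. \<bar>ln ((\<sigma> x)^2) - ln ((\<sigma> y)^2)\<bar>)"
  note [measurable] = Y_meas
  obtain L where lip: "L-lipschitz_on {0..1} \<mu>" using mu_lip by blast
  have L0: "0 \<le> L" by (rule lipschitz_on_nonneg[OF lip])
  obtain W where W: "\<And>x. x \<in> {0..1} \<Longrightarrow> \<bar>\<sigma> x\<bar> \<le> W" using cadlag01_bounded[OF sigma_cadlag] by blast
  have W0: "0 \<le> W" using W[of 0] by simp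
  define l where "l = blen s"
  define b where "b = bnum s"
  have b_lim: "filterlim (\<lambda>n. real (b n)) at_top ?F" and bl_lim: "((\<lambda>n. real (b n) / real (l n)) \<longlongrightarrow> 0) ?F"
    using admissible_limits[of s] s by (simp_all add: b_def l_def)
  have nlb: "n = l n * b n" if "n \<in> admissible_n s" "1 \<le> n" for n
    using admissible_blocks(3)[OF that] by (simp add: l_def b_def)
  have ev_good: "\<forall>\<^sub>F n in ?F. n = l n * b n \<and> 1 \<le> l n \<and> 2 \<le> b n"
  proof -
    have "\<forall>\<^sub>F n in ?F. 2 \<le> real (b n)"
      using b_lim by (rule filterlim_at_top[THEN iffD1, rule_format])
    moreover have "\<forall>\<^sub>F n in ?F. 1 \<le> n"
      by (rule filter_leD[OF inf_le1 eventually_ge_at_top])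
    moreover have "\<forall>\<^sub>F n in ?F. n \<in> admissible_n s"
      by (simp add: eventually_inf_principal)
    ultimately show ?thesis
    proof eventually_elim
      case (elim n)
      have "n = l n * b n" using elim by (intro nlb)
      moreover from this have "1 \<le> l n" using elim(2) by (cases "l n") auto
      ultimately show ?case using elim(1) by simp
    qed
  qed
  define U' where "U' n = (1 / (real (b n) * (real (b n) - 1))) * (\<Sum>j\<in>{1..b n}. \<Sum>k\<in>{1..b n} - {j}.
        \<bar>ln (block_scale \<sigma> (l n) n j) - ln (block_scale \<sigma> (l n) n k)\<bar>)" for n
  have U'_lim: "(U' \<longlongrightarrow> c) ?F"
    unfolding U'_def[abs_def] c_def
    by (rule block_scale_mean_difference_limit[OF sigma_cadlag sigma0 nlb b_lim])

  define B where "B n j = {(j - 1) * l n + 1..j * l n}" for n j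
  define \<nu> where "\<nu> n j = (1 / real (l n)) * (\<Sum>r\<in>B n j. \<mu> (real r / real n))" for n j
  define S1 where "S1 n j \<omega> = (\<Sum>i\<in>B n j. (\<sigma> (real i / real n))\<^sup>2 * ((Y i \<omega>)\<^sup>2 - 1))" for n j \<omega>
  define S2 where "S2 n j \<omega> = (\<Sum>i\<in>B n j. \<sigma> (real i / real n) * Y i \<omega>)" for n j \<omega>
  define S3 where "S3 n j \<omega> = (\<Sum>i\<in>B n j. (\<mu> (real i / real n) - \<nu> n j) * \<sigma> (real i / real n) * Y i \<omega>)" for n j \<omega>

  have sq_powr: "\<bar>y\<^sup>2\<bar> powr (2 + \<theta>) = \<bar>y\<bar> powr (4 + 2 * \<theta>)" for y :: real
  proof -
    have "\<bar>y\<^sup>2\<bar> = \<bar>y\<bar> powr 2" by simp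
    then show ?thesis by (simp only: powr_powr) (simp add: algebra_simps)
  qed
  have int_sq: "integrable M (\<lambda>\<omega>. \<bar>(Y 1 \<omega>)\<^sup>2\<bar> powr (2 + \<theta>))"
    unfolding sq_powr by (rule A1)
  have int_id: "integrable M (\<lambda>\<omega>. \<bar>Y 1 \<omega>\<bar> powr (2 + \<theta>))"
  proof (rule Bochner_Integration.integrable_bound)
    show "integrable M (\<lambda>\<omega>. 1 + \<bar>Y 1 \<omega>\<bar> powr (4 + 2 * \<theta>))" using A1 by simp
    show "AE \<omega> in M. norm (\<bar>Y 1 \<omega>\<bar> powr (2 + \<theta>)) \<le> norm (1 + \<bar>Y 1 \<omega>\<bar> powr (4 + 2 * \<theta>))"
    proof (rule AE_I2)
      fix \<omega>
      have "\<bar>Y 1 \<omega>\<bar> powr (2 + \<theta>) \<le> 1 + \<bar>Y 1 \<omega>\<bar> powr (4 + 2 * \<theta>)"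
      proof (cases "\<bar>Y 1 \<omega>\<bar> \<le> 1")
        case True
        then have "\<bar>Y 1 \<omega>\<bar> powr (2 + \<theta>) \<le> 1" using theta by (intro powr_le1) auto
        then show ?thesis by (meson add_increasing2 powr_ge_zero)
      next
        case False
        then have "\<bar>Y 1 \<omega>\<bar> powr (2 + \<theta>) \<le> \<bar>Y 1 \<omega>\<bar> powr (4 + 2 * \<theta>)" using theta by (intro powr_mono) auto
        then show ?thesis by simp
      qed
      then show "norm (\<bar>Y 1 \<omega>\<bar> powr (2 + \<theta>)) \<le> norm (1 + \<bar>Y 1 \<omega>\<bar> powr (4 + 2 * \<theta>))" by simp
    qed
  qed measurable
  have m2: "(\<integral>\<omega>. (Y 1 \<omega>)\<^sup>2 \<partial>M) = 1" using var1 mean0 by simp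
  have "(\<lambda>y::real. y\<^sup>2) \<in> borel_measurable borel" by measurable
  from weighted_sum_second_moment[OF stat Y_meas this theta int_sq A2, unfolded m2]
  obtain C1 where C1: "\<forall>B w V. finite B \<longrightarrow> B \<subseteq> {1..} \<longrightarrow> (\<forall>i\<in>B. \<bar>w i\<bar> \<le> V) \<longrightarrow>
      integrable M (\<lambda>\<omega>. (\<Sum>i\<in>B. w i * ((Y i \<omega>)\<^sup>2 - 1))\<^sup>2) \<and>
      (\<integral>\<omega>. (\<Sum>i\<in>B. w i * ((Y i \<omega>)\<^sup>2 - 1))\<^sup>2 \<partial>M) \<le> C1 * V\<^sup>2 * real (card B)"
    ..
  have "(\<lambda>y::real. y) \<in> borel_measurable borel" by measurable
  from weighted_sum_second_moment[OF stat Y_meas this theta int_id A2, unfolded mean0 diff_zero]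
  obtain C2 where C2: "\<forall>B w V. finite B \<longrightarrow> B \<subseteq> {1..} \<longrightarrow> (\<forall>i\<in>B. \<bar>w i\<bar> \<le> V) \<longrightarrow>
      integrable M (\<lambda>\<omega>. (\<Sum>i\<in>B. w i * Y i \<omega>)\<^sup>2) \<and>
      (\<integral>\<omega>. (\<Sum>i\<in>B. w i * Y i \<omega>)\<^sup>2 \<partial>M) \<le> C2 * V\<^sup>2 * real (card B)"
    ..

  show ?thesis
    unfolding tendsto_in_prob_def c_def[symmetric]
  proof (intro allI impI)
    fix \<epsilon> :: real assume \<epsilon>: "0 < \<epsilon>"
    define d where "d = min 1 (min (\<sigma>\<^sub>0\<^sup>2 / 10) (\<epsilon> * \<sigma>\<^sub>0\<^sup>2 / 40))"
    have d: "0 < d" "d \<le> 1" "5 * d \<le> \<sigma>\<^sub>0\<^sup>2 / 2" "40 * d \<le> \<epsilon> * \<sigma>\<^sub>0\<^sup>2"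
    proof -
      have "d \<le> \<sigma>\<^sub>0\<^sup>2 / 10" "d \<le> \<epsilon> * \<sigma>\<^sub>0\<^sup>2 / 40" by (simp_all add: d_def)
      then show "5 * d \<le> \<sigma>\<^sub>0\<^sup>2 / 2" "40 * d \<le> \<epsilon> * \<sigma>\<^sub>0\<^sup>2" by linarith+
      show "0 < d" "d \<le> 1" using \<epsilon> sigma0(1) by (simp_all add: d_def)
    qed
    define E where "E S n = (\<Union>j\<in>{1..b n}. {\<omega>\<in>space M. d * real (l n) \<le> \<bar>S n j \<omega>\<bar>})"
      for S :: "nat \<Rightarrow> nat \<Rightarrow> 'a \<Rightarrow> real" and n
    define K where "K = (C1 * (W\<^sup>2)\<^sup>2 + C2 * W\<^sup>2 + C2 * (L * W)\<^sup>2) / d\<^sup>2"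
    have "\<forall>\<^sub>F n in ?F. dist (U' n) c < \<epsilon> / 2"
      using U'_lim \<epsilon> by (intro tendstoD) auto
    moreover have "\<forall>\<^sub>F n in ?F. (L / real (b n))\<^sup>2 \<le> d"
    proof -
      have "((\<lambda>n. (L / real (b n))\<^sup>2) \<longlongrightarrow> 0\<^sup>2) ?F"
        by (intro tendsto_power tendsto_divide_0[OF tendsto_const] filterlim_at_top_imp_at_infinity b_lim)
      then have "\<forall>\<^sub>F n in ?F. (L / real (b n))\<^sup>2 < d" using d(1) by (intro order_tendstoD) auto
      then show ?thesis by eventually_elim simp
    qed
    ultimately have bound: "\<forall>\<^sub>F n in ?F. measure M {\<omega>\<in>space M. \<bar>U_stat \<sigma> \<mu> Y s n \<omega> - c\<bar> > \<epsilon>}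
        \<le> K * (real (b n) / real (l n))"
      using ev_good
    proof eventually_elim
      case (elim n)
      then have n: "n = l n * b n" "1 \<le> l n" "1 \<le> b n" and b2: "2 \<le> b n" by auto
      have l0: "0 < real (l n)" using n by simp
      have B: "finite (B n j)" "B n j \<subseteq> {1..}" for j by (auto simp: B_def)
      have card: "card (B n j) = l n" if "j \<in> {1..b n}" for j
        unfolding B_def using that by (intro block_card) simp
      have pt: "real i / real n \<in> {0..1}" if "j \<in> {1..b n}" "i \<in> B n j" for i j
        using that by (intro block_point_unit_interval(1)[OF n]) (auto simp: B_def)
      have w1: "\<forall>i\<in>B n j. \<bar>(\<sigma> (real i / real n))\<^sup>2\<bar> \<le> W\<^sup>2" if "j \<in> {1..b n}" for j
        using W[OF pt[OF that]] W0 by (auto intro!: power2_le_imp_le simp: abs_le_square_iff[symmetric])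
      have w2: "\<forall>i\<in>B n j. \<bar>\<sigma> (real i / real n)\<bar> \<le> W" if "j \<in> {1..b n}" for j
        using W[OF pt[OF that]] by auto
      have w3: "\<forall>i\<in>B n j. \<bar>(\<mu> (real i / real n) - \<nu> n j) * \<sigma> (real i / real n)\<bar> \<le> L * W" if j: "j \<in> {1..b n}" for j
      proof
        fix i assume i: "i \<in> B n j"
        have "\<bar>\<mu> (real i / real n) - \<nu> n j\<bar> \<le> L / real (b n)"
          using lipschitz_block_mean_deviation[OF n _ _ i[unfolded B_def] lip] j by (simp add: \<nu>_def B_def)
        also have "\<dots> \<le> L / 1" using L0 n by (intro divide_left_mono) auto
        finally show "\<bar>(\<mu> (real i / real n) - \<nu> n j) * \<sigma> (real i / real n)\<bar> \<le> L * W"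
          unfolding abs_mult using W[OF pt[OF j i]] L0 by (intro mult_mono) auto
      qed
      have S_meas: "S1 n j \<in> borel_measurable M" "S2 n j \<in> borel_measurable M" "S3 n j \<in> borel_measurable M" for j
        unfolding S1_def[abs_def] S2_def[abs_def] S3_def[abs_def] by measurable
      have p1: "prob (E S1 n) \<le> C1 * (W\<^sup>2)\<^sup>2 / d\<^sup>2 * (real (b n) / real (l n))"
        unfolding E_def
      proof (rule block_tail_bound[OF S_meas(1) _ _ l0 d(1)])
        fix j assume j: "j \<in> {1..b n}"
        show "integrable M (\<lambda>\<omega>. (S1 n j \<omega>)\<^sup>2)" "(\<integral>\<omega>. (S1 n j \<omega>)\<^sup>2 \<partial>M) \<le> C1 * (W\<^sup>2)\<^sup>2 * real (l n)"
          using C1[THEN spec, THEN spec, THEN spec, THEN mp, OF B(1), THEN mp, OF B(2), THEN mp, OF w1[OF j]]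
          unfolding S1_def card[OF j] by (rule conjunct1, elim conjunct2)
      qed
      have p2: "prob (E S2 n) \<le> C2 * W\<^sup>2 / d\<^sup>2 * (real (b n) / real (l n))"
        unfolding E_def
      proof (rule block_tail_bound[OF S_meas(2) _ _ l0 d(1)])
        fix j assume j: "j \<in> {1..b n}"
        show "integrable M (\<lambda>\<omega>. (S2 n j \<omega>)\<^sup>2)" "(\<integral>\<omega>. (S2 n j \<omega>)\<^sup>2 \<partial>M) \<le> C2 * W\<^sup>2 * real (l n)"
          using C2[THEN spec, THEN spec, THEN spec, THEN mp, OF B(1), THEN mp, OF B(2), THEN mp, OF w2[OF j]]
          unfolding S2_def card[OF j] by (rule conjunct1, elim conjunct2)
      qed
      have p3: "prob (E S3 n) \<le> C2 * (L * W)\<^sup>2 / d\<^sup>2 * (real (b n) / real (l n))"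
        unfolding E_def
      proof (rule block_tail_bound[OF S_meas(3) _ _ l0 d(1)])
        fix j assume j: "j \<in> {1..b n}"
        show "integrable M (\<lambda>\<omega>. (S3 n j \<omega>)\<^sup>2)" "(\<integral>\<omega>. (S3 n j \<omega>)\<^sup>2 \<partial>M) \<le> C2 * (L * W)\<^sup>2 * real (l n)"
          using C2[THEN spec, THEN spec, THEN spec, THEN mp, OF B(1), THEN mp, OF B(2), THEN mp, OF w3[OF j]]
          unfolding S3_def card[OF j] by (rule conjunct1, elim conjunct2)
      qed
      have E_sets: "E S1 n \<in> sets M" "E S2 n \<in> sets M" "E S3 n \<in> sets M"
        unfolding E_def using S_meas[measurable] by measurable
      have "{\<omega>\<in>space M. \<bar>U_stat \<sigma> \<mu> Y s n \<omega> - c\<bar> > \<epsilon>} \<subseteq> E S1 n \<union> E S2 n \<union> E S3 n"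
      proof (rule subsetI, rule ccontr)
        fix \<omega> assume \<omega>: "\<omega> \<in> {\<omega>\<in>space M. \<bar>U_stat \<sigma> \<mu> Y s n \<omega> - c\<bar> > \<epsilon>}" "\<omega> \<notin> E S1 n \<union> E S2 n \<union> E S3 n"
        have close: "\<bar>ln (block_var \<sigma> \<mu> Y s n j \<omega>) - ln (block_scale \<sigma> (l n) n j)\<bar> \<le> \<epsilon> / 4" if j: "j \<in> {1..b n}" for j
        proof -
          have S: "\<bar>S1 n j \<omega>\<bar> < d * real (l n)" "\<bar>S2 n j \<omega>\<bar> < d * real (l n)" "\<bar>S3 n j \<omega>\<bar> < d * real (l n)"
            using \<omega> j by (auto simp: E_def not_le)
          have j': "1 \<le> j" "j \<le> b n" using j by auto
          have "\<bar>block_var \<sigma> \<mu> Y s n j \<omega> - block_scale \<sigma> (l n) n j\<bar> \<le> 5 * d"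
            using elim(2) S
            by (intro block_var_approximation[OF _ n j' lip d(1,2)])
              (simp_all add: S1_def S2_def S3_def B_def \<nu>_def l_def)
          moreover have "\<sigma>\<^sub>0\<^sup>2 \<le> block_scale \<sigma> (l n) n j"
            using W sigma0 by (intro block_scale_bounds(1)[OF n j', of _ _ W]) (auto simp: abs_le_iff)
          ultimately have "\<bar>ln (block_var \<sigma> \<mu> Y s n j \<omega>) - ln (block_scale \<sigma> (l n) n j)\<bar>
              \<le> 2 * \<bar>block_var \<sigma> \<mu> Y s n j \<omega> - block_scale \<sigma> (l n) n j\<bar> / \<sigma>\<^sub>0\<^sup>2"
            using d(3) sigma0(1) by (intro abs_ln_diff_le) auto
          also have "\<dots> \<le> 2 * (5 * d) / \<sigma>\<^sub>0\<^sup>2"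
            using \<open>\<bar>block_var \<sigma> \<mu> Y s n j \<omega> - block_scale \<sigma> (l n) n j\<bar> \<le> 5 * d\<close>
            by (intro divide_right_mono mult_left_mono) auto
          also have "\<dots> \<le> \<epsilon> / 4" using d(4) sigma0(1) by (simp add: field_simps)
          finally show ?thesis .
        qed
        have "\<bar>U_stat \<sigma> \<mu> Y s n \<omega> - U' n\<bar> \<le> 2 * (\<epsilon> / 4)"
          using mean_abs_difference_perturbation[OF b2 close] by (simp add: U_stat_def Let_def U'_def b_def)
        with elim(1) have "\<bar>U_stat \<sigma> \<mu> Y s n \<omega> - c\<bar> \<le> \<epsilon>" unfolding dist_real_def by linarith
        with \<omega> show False by simp
      qed
      then have "prob {\<omega>\<in>space M. \<bar>U_stat \<sigma> \<mu> Y s n \<omega> - c\<bar> > \<epsilon>} \<le> prob (E S1 n \<union> E S2 n \<union> E S3 n)"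
        using E_sets by (intro finite_measure_mono) auto
      also have "\<dots> \<le> prob (E S1 n) + prob (E S2 n) + prob (E S3 n)"
        using measure_Un_le[of "E S1 n \<union> E S2 n" M "E S3 n"]
          measure_Un_le[of "E S1 n" M "E S2 n"] E_sets by simp
      also have "\<dots> \<le> K * (real (b n) / real (l n))"
        using p1 p2 p3 by (simp add: K_def add_divide_distrib distrib_right)
      finally show ?case .
    qed
    show "((\<lambda>n. measure M {\<omega>\<in>space M. \<bar>U_stat \<sigma> \<mu> Y s n \<omega> - c\<bar> > \<epsilon>}) \<longlongrightarrow> 0) ?F"
    proof (rule tendsto_sandwich[OF _ bound tendsto_const])
      show "((\<lambda>n. K * (real (b n) / real (l n))) \<longlongrightarrow> 0) ?F"
        using tendsto_mult_right_zero[OF bl_lim] by simp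
    qed simp
  qed
qed

end
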